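(* Let $T>0$, $\alpha>0$, $\theta_0>0$, let $(\theta_t)_{t\in[0,T]}$ be a positive deterministic (Borel measurable) function, and let $(p_t)_{t\in[0,T]}$ be a continuously differentiable function with $\sup_{t\in[0,T]}(|p_t|+|\dot p_t|)<\infty$ and $p_t\in(0,1)$ for all $t\in[0,T]$. Assume condition (A): for all $t\in[0,T]$, $0\le \dot p_t+\theta_tp_t\le\theta_t$, and $\sup_{t\in[0,T]}|\theta_t|<\infty$. Let $x_0\in(0,1)$ and let $(X_t)_{t\in[0,T]}$ be the unique strong $[0,1]$-valued solution of $$dX_t=\big(\dot p_t-\theta_t(X_t-p_t)\big)\,dt+\sqrt{2\alpha\theta_0X_t(1-X_t)}\,dW_t,\qquad X_0=x_0,$$ where $W$ is a standard Brownian motion. Assume moreover condition (B): $$\theta_t\ \ge\ \max\left(\frac{\alpha\theta_0+\dot p_t}{1-p_t},\ \frac{\alpha\theta_0-\dot p_t}{p_t}\right)\quad\text{for all }t\in[0,T].$$ Define $\tau_0=\inf\{t\in[0,T]: X_t=0\}$ and $\tau_1=\inf\{t\in[0,T]: X_t=1\}$, with $\inf\emptyset=+\infty$. Then $\tau_0=\tau_1=+\infty$ almost surely, i.e. almost surely $X_t\in(0,1)$ for all $t\in[0,T]$.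
   Context: $\dot p_t$ denotes the time derivative of $p_t$. Existence and uniqueness of the $[0,1]$-valued strong solution under condition (A) is assumed as given. *)

theory Defs
  imports "HOL-Probability.Probability"
begin

definition is_filtration :: "'a measure \<Rightarrow> (real \<Rightarrow> 'a measure) \<Rightarrow> bool" where
  "is_filtration M F \<longleftrightarrow>
     (\<forall>t. space (F t) = space M \<and> sets (F t) \<subseteq> sets M) \<and>
     (\<forall>s t. s \<le> t \<longrightarrow> sets (F s) \<subseteq> sets (F t))"

definition adapted_on :: "real \<Rightarrow> (real \<Rightarrow> 'a measure) \<Rightarrow> (real \<Rightarrow> 'a \<Rightarrow> real) \<Rightarrow> bool" where
  "adapted_on T F X \<longleftrightarrow> (\<forall>t\<in>{0..T}. X t \<in> borel_measurable (F t))"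

definition brownian_motion ::
  "'a measure \<Rightarrow> (real \<Rightarrow> 'a measure) \<Rightarrow> real \<Rightarrow> (real \<Rightarrow> 'a \<Rightarrow> real) \<Rightarrow> bool" where
  "brownian_motion M F T W \<longleftrightarrow>
     prob_space M \<and> is_filtration M F \<and> adapted_on T F W \<and>
     (\<forall>\<omega>\<in>space M. W 0 \<omega> = 0 \<and> continuous_on {0..T} (\<lambda>t. W t \<omega>)) \<and>
     (\<forall>s t. 0 \<le> s \<and> s < t \<and> t \<le> T \<longrightarrow>
        (\<forall>A\<in>sets (F s). \<forall>B\<in>sets borel.
           measure M (A \<inter> {\<omega>\<in>space M. W t \<omega> - W s \<omega> \<in> B})
             = measure M A * measure (density lborel (normal_density 0 (sqrt (t - s)))) B))"

definition ito_sum :: "(real \<Rightarrow> 'a \<Rightarrow> real) \<Rightarrow> (real \<Rightarrow> 'a \<Rightarrow> real) \<Rightarrow> real \<Rightarrow> nat \<Rightarrow> 'a \<Rightarrow> real" where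
  "ito_sum W H t n \<omega> =
     (\<Sum>k<2^n. H (real k * t / 2^n) \<omega> *
                (W (real (Suc k) * t / 2^n) \<omega> - W (real k * t / 2^n) \<omega>))"

text \<open>I is (a version of) the Ito integral of the continuous adapted integrand H over [0,t]:
  the limit in probability of the left-point Riemann sums along dyadic partitions.
  For continuous adapted integrands this limit exists and equals the Ito integral.\<close>
definition is_ito_integral ::
  "'a measure \<Rightarrow> (real \<Rightarrow> 'a \<Rightarrow> real) \<Rightarrow> (real \<Rightarrow> 'a \<Rightarrow> real) \<Rightarrow> real \<Rightarrow> ('a \<Rightarrow> real) \<Rightarrow> bool" where
  "is_ito_integral M W H t I \<longleftrightarrow>
     (\<forall>\<epsilon>>0. (\<lambda>n. measure M {\<omega>\<in>space M. \<bar>ito_sum W H t n \<omega> - I \<omega>\<bar> > \<epsilon>}) \<longlonglongrightarrow> 0)"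

definition strong_solution ::
  "'a measure \<Rightarrow> (real \<Rightarrow> 'a measure) \<Rightarrow> real \<Rightarrow> (real \<Rightarrow> 'a \<Rightarrow> real) \<Rightarrow>
   (real \<Rightarrow> real \<Rightarrow> real) \<Rightarrow> (real \<Rightarrow> real) \<Rightarrow> real \<Rightarrow> (real \<Rightarrow> 'a \<Rightarrow> real) \<Rightarrow> bool" where
  "strong_solution M F T W b \<sigma> x0 X \<longleftrightarrow>
     adapted_on T F X \<and>
     (\<forall>\<omega>\<in>space M. X 0 \<omega> = x0 \<and> continuous_on {0..T} (\<lambda>t. X t \<omega>) \<and>
                    (\<forall>t\<in>{0..T}. X t \<omega> \<in> {0..1})) \<and>
     (\<forall>t\<in>{0..T}. is_ito_integral M W (\<lambda>s \<omega>. \<sigma> (X s \<omega>)) t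
                    (\<lambda>\<omega>. X t \<omega> - x0 - integral {0..t} (\<lambda>s. b s (X s \<omega>))))"

end

theory Submission
  imports Defs
begin

text \<open>
  Both boundaries are handled by the same argument, applied to X and to 1 - X: the drift has the form
  \<open>\<beta> t - \<theta> t * x\<close> with \<open>\<beta> \<ge> a\<close>, and the squared volatility is at most \<open>2 * a * x\<close>, where
  \<open>a = \<alpha> * \<theta>0\<close>. Then the generator applied to \<open>V x = - ln (x + \<epsilon>)\<close> is at most \<open>sup \<theta>\<close>,
  uniformly in \<open>\<epsilon>\<close>, so \<open>V (X t) - t * sup \<theta>\<close> is a supermartingale. The maximal inequality bounds the
  probability that X goes below \<open>\<epsilon>\<close> by a constant over \<open>- ln (2 * \<epsilon>)\<close>; now let \<open>\<epsilon> \<rightarrow> 0\<close>.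

  Ito's formula is replaced by a third-order Taylor expansion over the steps of the dyadic grids of [0,T],
  whose errors are controlled by the fourth moments of the increments. The properties of the stochastic
  integral that this needs are obtained from its approximating sums by Fatou's lemma along an almost surely
  convergent subsequence.
\<close>

section \<open>Moments of martingale transforms of Brownian motion\<close>

text \<open>The solution property says only that, for each fixed t, left-point sums over partitions
  of [0,t] converge in probability to \<open>X t - x0\<close> minus the drift integral. It does not
  contain additivity in t or the martingale property of the limit, and the drift is only shown
  measurable for \<open>M\<close>. Hence all conditioning happens on the level of the sums, whose
  coefficients are adapted, and only upper bounds for expectations of integrands bounded below are
  carried to the limit.

  Why the logarithm fits: the generator is at most -a/(x+\<epsilon>) + \<theta> x/(x+\<epsilon>) + a
  x/(x+\<epsilon>)^2. The two terms with a add up to -a \<epsilon>/(x+\<epsilon>)^2, and the middle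
  one is at most \<theta>. Condition (B) says precisely that \<beta> >= a near 0 and, for 1 - X,
  \<theta> - \<beta> >= a near 1.

  The order of the limits matters. For fixed \<epsilon> a step of length h has an error
  C(\<epsilon>) h^(3/2), so all steps together cost T C(\<epsilon>) sqrt h, which vanishes as the
  grid is refined. Only afterwards may \<epsilon> tend to 0, because C(\<epsilon>) blows up.\<close>

locale brownian_setup = prob_space M for M :: "'a measure" +
  fixes F :: "real \<Rightarrow> 'a measure" and T :: real and W :: "real \<Rightarrow> 'a \<Rightarrow> real"
  assumes BM: "brownian_motion M F T W"
begin

lemma subalgebra_filtration: "subalgebra M (F t)"
  using BM by (auto simp: brownian_motion_def is_filtration_def subalgebra_def)

lemma filtration_mono: "s \<le> t \<Longrightarrow> subalgebra (F t) (F s)"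
  using BM by (auto simp: brownian_motion_def is_filtration_def subalgebra_def)

lemma filtration_measurable: "Z \<in> measurable (F s) N \<Longrightarrow> Z \<in> measurable M N"
  by (rule measurable_from_subalg[OF subalgebra_filtration])

lemma filtration_measurable_mono: "Z \<in> measurable (F s) N \<Longrightarrow> s \<le> t \<Longrightarrow> Z \<in> measurable (F t) N"
  by (rule measurable_from_subalg[OF filtration_mono])

lemma brownian_adapted: "t \<in> {0..T} \<Longrightarrow> W t \<in> borel_measurable (F t)"
  using BM by (auto simp: brownian_motion_def adapted_on_def)

lemma increment_indep:
  assumes "0 \<le> s" "s < t" "t \<le> T" "A \<in> sets (F s)" "B \<in> sets borel"
  shows "prob (A \<inter> {\<omega>\<in>space M. W t \<omega> - W s \<omega> \<in> B})
    = prob A * measure (density lborel (normal_density 0 (sqrt (t - s)))) B"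
  using BM assms unfolding brownian_motion_def by blast

text \<open>The product formula in the definition of Brownian motion, taken with the whole space for
  \<open>A\<close>, identifies the law of the increment.\<close>

lemma increment_distributed:
  assumes st: "0 \<le> s" "s < t" "t \<le> T"
  shows "distributed M lborel (\<lambda>\<omega>. W t \<omega> - W s \<omega>) (normal_density 0 (sqrt (t - s)))"
proof -
  let ?D = "\<lambda>\<omega>. W t \<omega> - W s \<omega>"
  have [measurable]: "W t \<in> borel_measurable M" "W s \<in> borel_measurable M"
    using st by (auto intro!: filtration_measurable brownian_adapted)
  interpret N: prob_space "density lborel (normal_density 0 (sqrt (t - s)))"
    using st by (intro prob_space_normal_density) auto
  have "distr M lborel ?D = density lborel (normal_density 0 (sqrt (t - s)))"
  proof (rule measure_eqI)
    fix B assume "B \<in> sets (distr M lborel ?D)"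
    then have [measurable]: "B \<in> sets borel" by simp
    have "space M \<in> sets (F s)"
      using subalgebra_filtration[of s] by (metis sets.top subalgebra_def)
    from increment_indep[OF st this, of B]
    have "prob (space M \<inter> {\<omega>\<in>space M. ?D \<omega> \<in> B}) = measure (density lborel (normal_density 0 (sqrt (t - s)))) B"
      by (simp add: prob_space)
    moreover have "space M \<inter> {\<omega>\<in>space M. ?D \<omega> \<in> B} = ?D -` B \<inter> space M" by auto
    ultimately show "emeasure (distr M lborel ?D) B = emeasure (density lborel (normal_density 0 (sqrt (t - s)))) B"
      by (simp add: emeasure_distr emeasure_eq_measure N.emeasure_eq_measure)
  qed simp
  then show ?thesis
    by (auto simp: distributed_def)
qed

text \<open>The definition factorises over \<open>F s\<close> with the normal law in place of the
  law of the increment. The case \<open>A = space M\<close> exchanges the two, and the product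
  formula on preimages extends to the generated sigma-algebras because preimages are stable under
  intersection.\<close>

lemma increment_indep_var:
  assumes st: "0 \<le> s" "s < t" "t \<le> T" and Z: "Z \<in> borel_measurable (F s)"
  shows "indep_var borel Z borel (\<lambda>\<omega>. W t \<omega> - W s \<omega>)"
proof -
  let ?D = "\<lambda>\<omega>. W t \<omega> - W s \<omega>"
  have [measurable]: "W t \<in> borel_measurable M" "W s \<in> borel_measurable M" "Z \<in> borel_measurable M"
    using st Z by (auto intro!: filtration_measurable brownian_adapted)
  have sp: "space (F s) = space M"
    using subalgebra_filtration[of s] by (simp add: subalgebra_def)
  interpret N: prob_space "density lborel (normal_density 0 (sqrt (t - s)))"
    using st by (intro prob_space_normal_density) auto
  have top: "space M \<in> sets (F s)" using sp by (metis sets.top)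
  have eq: "?D -` B \<inter> space M = {\<omega>\<in>space M. ?D \<omega> \<in> B}" for B by auto
  have "indep_set {Z -` A \<inter> space M |A. A \<in> sets borel} {?D -` A \<inter> space M |A. A \<in> sets borel}"
  proof (unfold indep_sets2_eq, intro conjI ballI)
    fix a b assume "a \<in> {Z -` A \<inter> space M |A. A \<in> sets borel}" "b \<in> {?D -` A \<inter> space M |A. A \<in> sets borel}"
    then obtain A B where AB: "a = Z -` A \<inter> space M" "b = ?D -` B \<inter> space M" "A \<in> sets borel" "B \<in> sets borel"
      by auto
    have a: "a \<in> sets (F s)" using measurable_sets[OF Z AB(3)] AB(1) sp by simp
    have "prob (space M \<inter> b) = prob (space M) * measure (density lborel (normal_density 0 (sqrt (t - s)))) B"
      unfolding AB(2) eq using increment_indep[OF st top AB(4)] .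
    moreover have "space M \<inter> b = b" using AB by auto
    ultimately have b: "prob b = measure (density lborel (normal_density 0 (sqrt (t - s)))) B"
      by (simp add: prob_space)
    show "prob (a \<inter> b) = prob a * prob b"
      unfolding b unfolding AB(2) eq using increment_indep[OF st a AB(4)] .
  qed auto
  then have "indep_set (sigma_sets (space M) {Z -` A \<inter> space M |A. A \<in> sets borel})
      (sigma_sets (space M) {?D -` A \<inter> space M |A. A \<in> sets borel})"
  proof (rule indep_set_sigma_sets)
    show "Int_stable {Z -` A \<inter> space M |A. A \<in> sets borel}"
    proof (rule Int_stableI, safe)
      fix A B :: "real set" assume "A \<in> sets borel" "B \<in> sets borel"
      then show "\<exists>C. Z -` A \<inter> space M \<inter> (Z -` B \<inter> space M) = Z -` C \<inter> space M \<and> C \<in> sets borel"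
        by (intro exI[of _ "A \<inter> B"]) auto
    qed
    show "Int_stable {?D -` A \<inter> space M |A. A \<in> sets borel}"
    proof (rule Int_stableI, safe)
      fix A B :: "real set" assume "A \<in> sets borel" "B \<in> sets borel"
      then show "\<exists>C. ?D -` A \<inter> space M \<inter> (?D -` B \<inter> space M) = ?D -` C \<inter> space M \<and> C \<in> sets borel"
        by (intro exI[of _ "A \<inter> B"]) auto
    qed
  qed
  then show ?thesis unfolding indep_var_eq by simp
qed

lemma increment_power:
  assumes st: "0 \<le> s" "s < t" "t \<le> T"
  shows integrable_increment_power: "integrable M (\<lambda>\<omega>. (W t \<omega> - W s \<omega>) ^ j)"
    and expectation_increment_power: "expectation (\<lambda>\<omega>. (W t \<omega> - W s \<omega>) ^ j)
      = (\<integral>x. normal_density 0 (sqrt (t - s)) x * x ^ j \<partial>lborel)"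
  using distributed_integrable[OF increment_distributed[OF st], of "\<lambda>x. x ^ j"]
    distributed_integral[OF increment_distributed[OF st], of "\<lambda>x. x ^ j"]
    integrable_normal_moment[of "sqrt (t - s)" 0 j] st
  by auto

lemma increment_moments:
  assumes st: "0 \<le> s" "s < t" "t \<le> T"
  shows "expectation (\<lambda>\<omega>. (W t \<omega> - W s \<omega>) ^ 1) = 0"
    "expectation (\<lambda>\<omega>. (W t \<omega> - W s \<omega>) ^ 2) = t - s"
    "expectation (\<lambda>\<omega>. (W t \<omega> - W s \<omega>) ^ 3) = 0"
    "expectation (\<lambda>\<omega>. (W t \<omega> - W s \<omega>) ^ 4) = 3 * (t - s)\<^sup>2"
  unfolding expectation_increment_power[OF st]
  using integral_normal_moment_odd[of "sqrt (t - s)" 0 0] integral_normal_moment_odd[of "sqrt (t - s)" 0 1]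
    integral_normal_moment_even[of "sqrt (t - s)" 0 1] integral_normal_moment_even[of "sqrt (t - s)" 0 2] st
  by (auto simp: fact_numeral power_divide)

text \<open>Stands in for conditioning on \<open>F s\<close>: a factor known at time s splits off
  every power of the following increment, so no conditional expectations occur below.\<close>

lemma increment_product:
  assumes st: "0 \<le> s" "s < t" "t \<le> T" and Z: "Z \<in> borel_measurable (F s)" "integrable M Z"
  shows integrable_increment_product: "integrable M (\<lambda>\<omega>. Z \<omega> * (W t \<omega> - W s \<omega>) ^ j)"
    and expectation_increment_product: "expectation (\<lambda>\<omega>. Z \<omega> * (W t \<omega> - W s \<omega>) ^ j)
      = expectation Z * expectation (\<lambda>\<omega>. (W t \<omega> - W s \<omega>) ^ j)"
proof -
  have ind: "indep_var borel Z borel (\<lambda>\<omega>. (W t \<omega> - W s \<omega>) ^ j)"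
    using indep_var_compose[OF increment_indep_var[OF st Z(1)], of "\<lambda>x. x" borel "\<lambda>x. x ^ j" borel]
    by (simp add: comp_def)
  show "integrable M (\<lambda>\<omega>. Z \<omega> * (W t \<omega> - W s \<omega>) ^ j)"
    by (rule indep_var_integrable[OF ind Z(2) integrable_increment_power[OF st]])
  show "expectation (\<lambda>\<omega>. Z \<omega> * (W t \<omega> - W s \<omega>) ^ j)
      = expectation Z * expectation (\<lambda>\<omega>. (W t \<omega> - W s \<omega>) ^ j)"
    by (rule indep_var_lebesgue_integral[OF ind Z(2) integrable_increment_power[OF st]])
qed

end

text \<open>A fourth moment dominates all lower powers through |x|^j <= 1 + x^4.\<close>

lemma (in finite_measure) integrable_bounded_mult_power:
  fixes f Z :: "'a \<Rightarrow> real"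
  assumes f: "f \<in> borel_measurable M" "integrable M (\<lambda>\<omega>. f \<omega> ^ 4)"
    and Z: "Z \<in> borel_measurable M" "\<And>\<omega>. \<omega> \<in> space M \<Longrightarrow> \<bar>Z \<omega>\<bar> \<le> C" and j: "j \<le> 4"
  shows "integrable M (\<lambda>\<omega>. Z \<omega> * f \<omega> ^ j)"
proof (rule Bochner_Integration.integrable_bound)
  show "integrable M (\<lambda>\<omega>. C * (1 + f \<omega> ^ 4))" using f by auto
  show "(\<lambda>\<omega>. Z \<omega> * f \<omega> ^ j) \<in> borel_measurable M" using f Z by auto
  have pow: "\<bar>x\<bar> ^ j \<le> 1 + x ^ 4" for x :: real
  proof (cases "\<bar>x\<bar> \<le> 1")
    case True
    then have "\<bar>x\<bar> ^ j \<le> 1" by (simp add: power_le_one)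
    then show ?thesis by (smt (verit) zero_le_even_power even_numeral)
  next
    case False
    then have "\<bar>x\<bar> ^ j \<le> \<bar>x\<bar> ^ 4" using j by (intro power_increasing) auto
    then show ?thesis by simp
  qed
  show "AE \<omega> in M. norm (Z \<omega> * f \<omega> ^ j) \<le> norm (C * (1 + f \<omega> ^ 4))"
  proof (rule AE_I2)
    fix \<omega> assume w: "\<omega> \<in> space M"
    then have "0 \<le> C" using Z(2)[OF w] by linarith
    have "\<bar>Z \<omega>\<bar> * \<bar>f \<omega>\<bar> ^ j \<le> C * (1 + f \<omega> ^ 4)"
      using Z(2)[OF w] pow \<open>0 \<le> C\<close> by (intro mult_mono) auto
    then show "norm (Z \<omega> * f \<omega> ^ j) \<le> norm (C * (1 + f \<omega> ^ 4))"
      using \<open>0 \<le> C\<close> by (simp add: abs_mult power_abs)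
  qed
qed

text \<open>Squaring (x + y)^2 <= 2 (x^2 + y^2) and applying the same bound to the squares; 8 = 2 *
  2^2.\<close>

lemma power4_add_le: "(x + y) ^ 4 \<le> 8 * (x ^ 4 + y ^ 4)" for x y :: real
proof -
  have "(x + y)\<^sup>2 \<le> 2 * (x\<^sup>2 + y\<^sup>2)" by (smt (verit) sum_squares_bound power2_sum)
  then have "((x + y)\<^sup>2)\<^sup>2 \<le> (2 * (x\<^sup>2 + y\<^sup>2))\<^sup>2" by (intro power_mono) auto
  also have "\<dots> \<le> 8 * ((x\<^sup>2)\<^sup>2 + (y\<^sup>2)\<^sup>2)"
    using sum_squares_bound[of "x\<^sup>2" "y\<^sup>2"] by (simp add: power2_sum power_mult_distrib)
  finally show ?thesis by (simp flip: power_mult)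
qed

definition transform_sum :: "(real \<Rightarrow> 'a \<Rightarrow> real) \<Rightarrow> (nat \<Rightarrow> 'a \<Rightarrow> real) \<Rightarrow> real \<Rightarrow> real \<Rightarrow> nat \<Rightarrow> 'a \<Rightarrow> real" where
  "transform_sum W G s \<delta> k \<omega> =
     (\<Sum>i<k. G i \<omega> * (W (s + real (Suc i) * \<delta>) \<omega> - W (s + real i * \<delta>) \<omega>))"

text \<open>The starting time \<open>s\<close> is kept separate from the grid index so that sums can
  be tested against weights that are known at time \<open>s\<close> but not earlier.\<close>

locale martingale_transform = brownian_setup +
  fixes G :: "nat \<Rightarrow> 'a \<Rightarrow> real" and s \<delta> c :: real and N :: nat
  assumes s_nonneg: "0 \<le> s" and \<delta>_pos: "0 < \<delta>" and grid_le: "s + real N * \<delta> \<le> T"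
    and G_adapted: "\<And>i. i < N \<Longrightarrow> G i \<in> borel_measurable (F (s + real i * \<delta>))"
    and G_bound: "\<And>i \<omega>. i < N \<Longrightarrow> \<omega> \<in> space M \<Longrightarrow> \<bar>G i \<omega>\<bar> \<le> c"
begin

abbreviation "S \<equiv> transform_sum W G s \<delta>"

lemma grid_point_le: "k \<le> N \<Longrightarrow> s + real k * \<delta> \<le> T"
  by (rule order_trans[OF _ grid_le]) (use \<delta>_pos in simp)

lemma grid_step:
  assumes "k < N"
  shows "0 \<le> s + real k * \<delta>" "s + real k * \<delta> < s + real (Suc k) * \<delta>" "s + real (Suc k) * \<delta> \<le> T"
    "s + real (Suc k) * \<delta> - (s + real k * \<delta>) = \<delta>"
  using assms s_nonneg \<delta>_pos grid_point_le[of "Suc k"] by (auto simp: algebra_simps)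

lemma S_Suc: "S (Suc k) \<omega> = S k \<omega> + G k \<omega> * (W (s + real (Suc k) * \<delta>) \<omega> - W (s + real k * \<delta>) \<omega>)"
  by (simp add: transform_sum_def)

lemma S_adapted: "k \<le> N \<Longrightarrow> S k \<in> borel_measurable (F (s + real k * \<delta>))"
proof (induction k)
  case 0
  then show ?case by (simp add: transform_sum_def[abs_def])
next
  case (Suc k)
  have k: "k < N" using Suc by simp
  note step = grid_step[OF k]
  have [measurable]: "S k \<in> borel_measurable (F (s + real (Suc k) * \<delta>))"
    "G k \<in> borel_measurable (F (s + real (Suc k) * \<delta>))"
    "W (s + real k * \<delta>) \<in> borel_measurable (F (s + real (Suc k) * \<delta>))"
    "W (s + real (Suc k) * \<delta>) \<in> borel_measurable (F (s + real (Suc k) * \<delta>))"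
    using Suc k step G_adapted[OF k]
      filtration_measurable_mono[OF brownian_adapted, of "s + real k * \<delta>" "s + real (Suc k) * \<delta>"]
    by (auto intro: filtration_measurable_mono[of _ "s + real k * \<delta>"] brownian_adapted)
  show ?case
    by (subst S_Suc[abs_def]) measurable
qed

lemma S_measurable: "k \<le> N \<Longrightarrow> S k \<in> borel_measurable M"
  using S_adapted filtration_measurable by blast

lemma G_measurable: "k < N \<Longrightarrow> G k \<in> borel_measurable M"
  using G_adapted filtration_measurable by blast

lemma S_power4_integrable: "k \<le> N \<Longrightarrow> integrable M (\<lambda>\<omega>. S k \<omega> ^ 4)"
proof (induction k)
  case 0
  then show ?case by (simp add: transform_sum_def)
next
  case (Suc k)
  have k: "k < N" using Suc by simp
  note step = grid_step[OF k]
  let ?D = "\<lambda>\<omega>. W (s + real (Suc k) * \<delta>) \<omega> - W (s + real k * \<delta>) \<omega>"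
  have [measurable]: "S k \<in> borel_measurable M" "G k \<in> borel_measurable M"
    and Dm: "?D \<in> borel_measurable M"
    using S_measurable G_measurable k step
    by (auto intro!: borel_measurable_diff filtration_measurable[OF brownian_adapted])
  have iD: "integrable M (\<lambda>\<omega>. ?D \<omega> ^ 4)"
    using integrable_increment_power[OF step(1-3)] .
  have "integrable M (\<lambda>\<omega>. G k \<omega> ^ 4 * ?D \<omega> ^ 4)"
  proof (rule integrable_bounded_mult_power[where C = "c ^ 4", OF Dm iD])
    show "\<bar>G k \<omega> ^ 4\<bar> \<le> c ^ 4" if "\<omega> \<in> space M" for \<omega>
      unfolding power_abs using G_bound[OF k that] by (intro power_mono) auto
  qed auto
  then have "integrable M (\<lambda>\<omega>. 8 * (S k \<omega> ^ 4 + G k \<omega> ^ 4 * ?D \<omega> ^ 4))"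
    using Suc by auto
  then show ?case
  proof (rule Bochner_Integration.integrable_bound)
    show "AE \<omega> in M. norm (S (Suc k) \<omega> ^ 4) \<le> norm (8 * (S k \<omega> ^ 4 + G k \<omega> ^ 4 * ?D \<omega> ^ 4))"
      using power4_add_le[of "S k _" "G k _ * ?D _"] by (simp add: S_Suc power_mult_distrib)
  qed (use S_measurable Suc in auto)
qed

lemma S_integrable:
  assumes "k \<le> N" "j \<le> 4" "Z \<in> borel_measurable M" "\<And>\<omega>. \<omega> \<in> space M \<Longrightarrow> \<bar>Z \<omega>\<bar> \<le> C"
  shows "integrable M (\<lambda>\<omega>. Z \<omega> * S k \<omega> ^ j)"
  using integrable_bounded_mult_power[OF S_measurable S_power4_integrable] assms by blast

text \<open>The martingale property given \<open>F s\<close>, expressed by bounded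
  \<open>F s\<close>-measurable weights \<open>Z\<close>: the newest increment has mean 0 and is
  independent of everything multiplying it.\<close>

lemma expectation_S:
  assumes Z: "Z \<in> borel_measurable (F s)" "\<And>\<omega>. \<omega> \<in> space M \<Longrightarrow> \<bar>Z \<omega>\<bar> \<le> C"
  shows "k \<le> N \<Longrightarrow> expectation (\<lambda>\<omega>. Z \<omega> * S k \<omega>) = 0"
proof (induction k)
  case 0
  then show ?case by (simp add: transform_sum_def)
next
  case (Suc k)
  have k: "k < N" using Suc by simp
  note step = grid_step[OF k]
  let ?D = "\<lambda>\<omega>. W (s + real (Suc k) * \<delta>) \<omega> - W (s + real k * \<delta>) \<omega>"
  have Zk[measurable]: "Z \<in> borel_measurable (F (s + real k * \<delta>))"
    by (rule filtration_measurable_mono[OF Z(1)]) (use \<delta>_pos in simp)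
  have ZM[measurable]: "Z \<in> borel_measurable M" by (rule filtration_measurable[OF Z(1)])
  have [measurable]: "G k \<in> borel_measurable (F (s + real k * \<delta>))" "G k \<in> borel_measurable M"
    using G_adapted G_measurable k by auto
  have ZG: "integrable M (\<lambda>\<omega>. Z \<omega> * G k \<omega>)"
  proof (rule integrable_const_bound[where B = "C * c"])
    show "AE \<omega> in M. norm (Z \<omega> * G k \<omega>) \<le> C * c"
      using Z(2) G_bound[OF k] by (intro AE_I2) (auto simp: abs_mult intro!: mult_mono' intro: order_trans[OF abs_ge_zero])
  qed measurable
  have ZGm: "(\<lambda>\<omega>. Z \<omega> * G k \<omega>) \<in> borel_measurable (F (s + real k * \<delta>))" by measurable
  have i1: "integrable M (\<lambda>\<omega>. Z \<omega> * S k \<omega>)"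
    using S_integrable[of k 1 Z C] k Z(2) by simp
  have i2: "integrable M (\<lambda>\<omega>. (Z \<omega> * G k \<omega>) * ?D \<omega> ^ 1)"
    by (rule integrable_increment_product[OF step(1-3) ZGm ZG])
  have "expectation (\<lambda>\<omega>. Z \<omega> * S (Suc k) \<omega>)
      = expectation (\<lambda>\<omega>. Z \<omega> * S k \<omega> + (Z \<omega> * G k \<omega>) * ?D \<omega> ^ 1)"
    by (simp add: S_Suc algebra_simps)
  also have "\<dots> = expectation (\<lambda>\<omega>. Z \<omega> * S k \<omega>) + expectation (\<lambda>\<omega>. (Z \<omega> * G k \<omega>) * ?D \<omega> ^ 1)"
    by (rule Bochner_Integration.integral_add[OF i1 i2])
  also have "\<dots> = 0"
    using Suc by (simp only: expectation_increment_product[OF step(1-3) ZGm ZG] increment_moments(1)[OF step(1-3)])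
  finally show ?case .
qed

text \<open>The Ito isometry conditional on \<open>F s\<close>, again in weighted form. When the
  square of the last partial sum is expanded, the mixed term contains a first power of the increment
  and vanishes.\<close>

lemma expectation_S_square:
  assumes Z: "Z \<in> borel_measurable (F s)" "\<And>\<omega>. \<omega> \<in> space M \<Longrightarrow> \<bar>Z \<omega>\<bar> \<le> C"
  shows "k \<le> N \<Longrightarrow> expectation (\<lambda>\<omega>. Z \<omega> * S k \<omega> ^ 2) = \<delta> * (\<Sum>i<k. expectation (\<lambda>\<omega>. Z \<omega> * G i \<omega> ^ 2))"
proof (induction k)
  case 0
  then show ?case by (simp add: transform_sum_def)
next
  case (Suc k)
  have k: "k < N" using Suc by simp
  note step = grid_step[OF k]
  let ?D = "\<lambda>\<omega>. W (s + real (Suc k) * \<delta>) \<omega> - W (s + real k * \<delta>) \<omega>"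
  have Zk[measurable]: "Z \<in> borel_measurable (F (s + real k * \<delta>))"
    by (rule filtration_measurable_mono[OF Z(1)]) (use \<delta>_pos in simp)
  have ZM[measurable]: "Z \<in> borel_measurable M" by (rule filtration_measurable[OF Z(1)])
  have [measurable]: "G k \<in> borel_measurable (F (s + real k * \<delta>))" "G k \<in> borel_measurable M"
    "S k \<in> borel_measurable (F (s + real k * \<delta>))" "S k \<in> borel_measurable M"
    using G_adapted G_measurable S_adapted S_measurable k by auto
  have bnd: "\<bar>Z \<omega> * G k \<omega> ^ j\<bar> \<le> C * c ^ j" if "\<omega> \<in> space M" for \<omega> j
    using Z(2)[OF that] G_bound[OF k that] 
    by (auto simp: abs_mult power_abs intro!: mult_mono' power_mono intro: order_trans[OF abs_ge_zero])
  have ZG2: "integrable M (\<lambda>\<omega>. Z \<omega> * G k \<omega> ^ 2)"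
    by (rule integrable_const_bound[where B = "C * c ^ 2"]) (use bnd in auto)
  have ZGm2: "(\<lambda>\<omega>. Z \<omega> * G k \<omega> ^ 2) \<in> borel_measurable (F (s + real k * \<delta>))" by measurable
  have ZSG: "integrable M (\<lambda>\<omega>. 2 * (Z \<omega> * G k \<omega>) * S k \<omega>)"
    using S_integrable[of k 1 "\<lambda>\<omega>. Z \<omega> * G k \<omega>" "C * c"] k bnd[of _ 1]
    by (auto simp: mult.assoc)
  have ZSGm: "(\<lambda>\<omega>. 2 * (Z \<omega> * G k \<omega>) * S k \<omega>) \<in> borel_measurable (F (s + real k * \<delta>))" by measurable
  have i1: "integrable M (\<lambda>\<omega>. Z \<omega> * S k \<omega> ^ 2)"
    using S_integrable[of k 2 Z C] k Z(2) by simp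
  note i2 = integrable_increment_product[OF step(1-3) ZSGm ZSG, of 1]
  note i3 = integrable_increment_product[OF step(1-3) ZGm2 ZG2, of 2]
  have "expectation (\<lambda>\<omega>. Z \<omega> * S (Suc k) \<omega> ^ 2)
      = expectation (\<lambda>\<omega>. Z \<omega> * S k \<omega> ^ 2 + 2 * (Z \<omega> * G k \<omega>) * S k \<omega> * ?D \<omega> ^ 1 + Z \<omega> * G k \<omega> ^ 2 * ?D \<omega> ^ 2)"
    by (simp add: S_Suc algebra_simps power2_eq_square)
  also have "\<dots> = expectation (\<lambda>\<omega>. Z \<omega> * S k \<omega> ^ 2)
      + expectation (\<lambda>\<omega>. 2 * (Z \<omega> * G k \<omega>) * S k \<omega> * ?D \<omega> ^ 1) + expectation (\<lambda>\<omega>. Z \<omega> * G k \<omega> ^ 2 * ?D \<omega> ^ 2)"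
    using i1 i2 i3 by (simp only: Bochner_Integration.integral_add Bochner_Integration.integrable_add)
  also have "\<dots> = \<delta> * (\<Sum>i<Suc k. expectation (\<lambda>\<omega>. Z \<omega> * G i \<omega> ^ 2))"
    using Suc k
    by (simp only: expectation_increment_product[OF step(1-3) ZSGm ZSG] expectation_increment_product[OF step(1-3) ZGm2 ZG2]
        increment_moments[OF step(1-3)] step(4)) (simp add: algebra_simps)
  finally show ?case .
qed

lemma expectation_S_square_le:
  assumes k: "k \<le> N"
  shows "expectation (\<lambda>\<omega>. S k \<omega> ^ 2) \<le> c\<^sup>2 * (real k * \<delta>)"
proof -
  have "expectation (\<lambda>\<omega>. S k \<omega> ^ 2) = \<delta> * (\<Sum>i<k. expectation (\<lambda>\<omega>. G i \<omega> ^ 2))"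
    using expectation_S_square[of "\<lambda>_. 1" 1 k] k by simp
  also have "(\<Sum>i<k. expectation (\<lambda>\<omega>. G i \<omega> ^ 2)) \<le> (\<Sum>i<k. c\<^sup>2)"
  proof (rule sum_mono)
    fix i assume "i \<in> {..<k}"
    then have i: "i < N" using k by simp
    have b: "G i \<omega> ^ 2 \<le> c\<^sup>2" if "\<omega> \<in> space M" for \<omega>
      using power_mono[OF G_bound[OF i that], of 2] by simp
    have "integrable M (\<lambda>\<omega>. G i \<omega> ^ 2)"
      by (rule integrable_const_bound[where B = "c\<^sup>2"]) (use G_measurable[OF i] b in auto)
    then have "expectation (\<lambda>\<omega>. G i \<omega> ^ 2) \<le> expectation (\<lambda>_. c\<^sup>2)"
      using b by (intro integral_mono) auto
    then show "expectation (\<lambda>\<omega>. G i \<omega> ^ 2) \<le> c\<^sup>2" by (simp add: prob_space)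
  qed
  finally show ?thesis using \<delta>_pos by (simp add: algebra_simps)
qed

text \<open>In the binomial expansion of the next fourth power the odd moments of the increment drop
  out, and the quadratic term is controlled by the second moment already bounded. The 3 is the
  fourth moment of the standard normal law.\<close>

lemma expectation_S_power4_le: "k \<le> N \<Longrightarrow> expectation (\<lambda>\<omega>. S k \<omega> ^ 4) \<le> 3 * c ^ 4 * (real k * \<delta>)\<^sup>2"
proof (induction k)
  case 0
  then show ?case by (simp add: transform_sum_def)
next
  case (Suc k)
  have k: "k < N" "k \<le> N" using Suc by simp_all
  note step = grid_step[OF k(1)]
  let ?D = "\<lambda>\<omega>. W (s + real (Suc k) * \<delta>) \<omega> - W (s + real k * \<delta>) \<omega>"
  have [measurable]: "G k \<in> borel_measurable (F (s + real k * \<delta>))" "G k \<in> borel_measurable M"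
    "S k \<in> borel_measurable (F (s + real k * \<delta>))" "S k \<in> borel_measurable M"
    using G_adapted G_measurable S_adapted S_measurable k by auto
  have bnd: "\<bar>G k \<omega> ^ j\<bar> \<le> c ^ j" if "\<omega> \<in> space M" for \<omega> j
    using G_bound[OF k(1) that] by (auto simp: power_abs intro!: power_mono)
  have int: "integrable M (\<lambda>\<omega>. r * G k \<omega> ^ i * S k \<omega> ^ j)" if "j \<le> 4" for i j r
  proof (rule S_integrable[OF k(2) that, where C = "\<bar>r\<bar> * c ^ i"])
    show "\<bar>r * G k \<omega> ^ i\<bar> \<le> \<bar>r\<bar> * c ^ i" if "\<omega> \<in> space M" for \<omega>
      using mult_left_mono[OF bnd[OF that, of i], of "\<bar>r\<bar>"] by (simp add: abs_mult)
  qed measurable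
  have meas: "(\<lambda>\<omega>. r * G k \<omega> ^ i * S k \<omega> ^ j) \<in> borel_measurable (F (s + real k * \<delta>))" for i j r
    by measurable
  note prod = integrable_increment_product[OF step(1-3) meas int]
    and exp = expectation_increment_product[OF step(1-3) meas int]
  have i1: "integrable M (\<lambda>\<omega>. S k \<omega> ^ 4)" using S_power4_integrable k by auto
  have le: "(3::nat) \<le> 4" "(2::nat) \<le> 4" "(1::nat) \<le> 4" "(0::nat) \<le> 4" by simp_all
  \<comment> \<open>The redundant factors \<open>g ^ 1\<close>, \<open>x ^ 0\<close> and
    \<open>1 *\<close> give every coefficient the common shape \<open>r * G ^ i * S ^ j\<close> of
    \<open>meas\<close> and \<open>int\<close>.\<close>
  have binom: "(x + g * d) ^ 4 = x ^ 4 + (4 * g ^ 1 * x ^ 3) * d ^ 1 + (6 * g ^ 2 * x ^ 2) * d ^ 2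
      + (4 * g ^ 3 * x ^ 1) * d ^ 3 + (1 * g ^ 4 * x ^ 0) * d ^ 4" for x g d :: real
    by (simp add: power4_eq_xxxx power3_eq_cube power2_eq_square) algebra
  have "expectation (\<lambda>\<omega>. S (Suc k) \<omega> ^ 4)
      = expectation (\<lambda>\<omega>. S k \<omega> ^ 4 + (4 * G k \<omega> ^ 1 * S k \<omega> ^ 3) * ?D \<omega> ^ 1 + (6 * G k \<omega> ^ 2 * S k \<omega> ^ 2) * ?D \<omega> ^ 2
        + (4 * G k \<omega> ^ 3 * S k \<omega> ^ 1) * ?D \<omega> ^ 3 + (1 * G k \<omega> ^ 4 * S k \<omega> ^ 0) * ?D \<omega> ^ 4)"
    by (simp only: S_Suc binom)
  also have "\<dots> = expectation (\<lambda>\<omega>. S k \<omega> ^ 4) + expectation (\<lambda>\<omega>. (4 * G k \<omega> ^ 1 * S k \<omega> ^ 3) * ?D \<omega> ^ 1)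
      + expectation (\<lambda>\<omega>. (6 * G k \<omega> ^ 2 * S k \<omega> ^ 2) * ?D \<omega> ^ 2)
        + expectation (\<lambda>\<omega>. (4 * G k \<omega> ^ 3 * S k \<omega> ^ 1) * ?D \<omega> ^ 3)
        + expectation (\<lambda>\<omega>. (1 * G k \<omega> ^ 4 * S k \<omega> ^ 0) * ?D \<omega> ^ 4)"
    using i1 prod[OF le(1)] prod[OF le(2)] prod[OF le(3)] prod[OF le(4)]
    by (simp only: Bochner_Integration.integral_add Bochner_Integration.integrable_add)
  also have "\<dots> = expectation (\<lambda>\<omega>. S k \<omega> ^ 4) + expectation (\<lambda>\<omega>. 6 * G k \<omega> ^ 2 * S k \<omega> ^ 2) * \<delta>
      + expectation (\<lambda>\<omega>. 1 * G k \<omega> ^ 4 * S k \<omega> ^ 0) * (3 * \<delta>\<^sup>2)"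
    by (simp only: exp[OF le(1)] exp[OF le(2)] exp[OF le(3)] exp[OF le(4)]
      increment_moments[OF step(1-3)] step(4) mult_zero_right add_0_right)
  also have "\<dots> \<le> 3 * c ^ 4 * (real k * \<delta>)\<^sup>2 + (6 * c\<^sup>2 * (c\<^sup>2 * (real k * \<delta>))) * \<delta> + c ^ 4 * (3 * \<delta>\<^sup>2)"
  proof (intro add_mono mult_right_mono)
    show "expectation (\<lambda>\<omega>. S k \<omega> ^ 4) \<le> 3 * c ^ 4 * (real k * \<delta>)\<^sup>2" using Suc by simp
    have i2: "integrable M (\<lambda>\<omega>. 1 * S k \<omega> ^ 2)" using int[of 2 1 0] by simp
    have "expectation (\<lambda>\<omega>. 6 * G k \<omega> ^ 2 * S k \<omega> ^ 2) \<le> expectation (\<lambda>\<omega>. 6 * c\<^sup>2 * S k \<omega> ^ 2)"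
    proof (rule integral_mono)
      fix \<omega> assume "\<omega> \<in> space M"
      then show "6 * G k \<omega> ^ 2 * S k \<omega> ^ 2 \<le> 6 * c\<^sup>2 * S k \<omega> ^ 2"
        using bnd[of \<omega> 2] by (intro mult_right_mono) auto
    qed (use int[of 2 6 2] i2 in auto)
    also have "\<dots> \<le> 6 * c\<^sup>2 * (c\<^sup>2 * (real k * \<delta>))"
      using expectation_S_square_le[OF k(2)] by (simp add: mult_left_mono)
    finally show "expectation (\<lambda>\<omega>. 6 * G k \<omega> ^ 2 * S k \<omega> ^ 2) \<le> 6 * c\<^sup>2 * (c\<^sup>2 * (real k * \<delta>))" .
    have "expectation (\<lambda>\<omega>. 1 * G k \<omega> ^ 4 * S k \<omega> ^ 0) \<le> expectation (\<lambda>\<omega>. c ^ 4)"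
      using int[of 0 1 4] bnd[of _ 4] by (intro integral_mono) auto
    then show "expectation (\<lambda>\<omega>. 1 * G k \<omega> ^ 4 * S k \<omega> ^ 0) \<le> c ^ 4" by (simp add: prob_space)
  qed (use \<delta>_pos in auto)
  \<comment> \<open>The induction closes exactly: 3 k^2 + 6 k + 3 = 3 (k + 1)^2.\<close>
  also have "\<dots> = 3 * c ^ 4 * (real (Suc k) * \<delta>)\<^sup>2"
    by (simp add: algebra_simps power2_eq_square power4_eq_xxxx)
  finally show ?case .
qed

end

section \<open>Convergence in probability\<close>

context prob_space
begin

text \<open>The functional \<open>expectation (min 1 \<bar>Y\<bar>)\<close> metrises convergence in
  probability. It obeys a triangle inequality and turns the convergence into one in L1, where almost
  surely convergent subsequences are available.\<close>

lemma expectation_min_tendsto_zero: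
  fixes Y :: "nat \<Rightarrow> 'a \<Rightarrow> real"
  assumes Y[measurable]: "\<And>n. Y n \<in> borel_measurable M"
    and lim: "\<And>\<epsilon>. \<epsilon> > 0 \<Longrightarrow> (\<lambda>n. prob {\<omega>\<in>space M. \<bar>Y n \<omega>\<bar> > \<epsilon>}) \<longlonglongrightarrow> 0"
  shows "(\<lambda>n. expectation (\<lambda>\<omega>. min 1 \<bar>Y n \<omega>\<bar>)) \<longlonglongrightarrow> 0"
proof (rule tendstoI)
  fix e :: real assume e: "e > 0"
  have "\<forall>\<^sub>F n in sequentially. dist (prob {\<omega>\<in>space M. \<bar>Y n \<omega>\<bar> > e / 2}) 0 < e / 2"
    using lim[of "e / 2"] e by (intro tendstoD) auto
  then show "\<forall>\<^sub>F n in sequentially. dist (expectation (\<lambda>\<omega>. min 1 \<bar>Y n \<omega>\<bar>)) 0 < e"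
  proof eventually_elim
    case (elim n)
    let ?A = "{\<omega>\<in>space M. \<bar>Y n \<omega>\<bar> > e / 2}"
    have "expectation (\<lambda>\<omega>. min 1 \<bar>Y n \<omega>\<bar>) \<le> expectation (\<lambda>\<omega>. e / 2 + indicator ?A \<omega>)"
    proof (rule integral_mono)
      show "integrable M (\<lambda>\<omega>. min 1 \<bar>Y n \<omega>\<bar>)"
        by (rule integrable_const_bound[where B = 1]) auto
      show "integrable M (\<lambda>\<omega>. e / 2 + indicator ?A \<omega> :: real)"
        by (intro Bochner_Integration.integrable_add integrable_const) (auto simp: emeasure_eq_measure)
    qed (use e in \<open>auto simp: indicator_def\<close>)
    also have "\<dots> = e / 2 + prob ?A"
      by (subst Bochner_Integration.integral_add) (auto simp: prob_space emeasure_eq_measure)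
    finally have "expectation (\<lambda>\<omega>. min 1 \<bar>Y n \<omega>\<bar>) < e" using elim by simp
    moreover have "0 \<le> expectation (\<lambda>\<omega>. min 1 \<bar>Y n \<omega>\<bar>)" by (intro integral_nonneg_AE) auto
    ultimately show ?case by simp
  qed
qed

lemma expectation_min_tendsto_zero_L2:
  fixes Y :: "nat \<Rightarrow> 'a \<Rightarrow> real"
  assumes Y[measurable]: "\<And>n. Y n \<in> borel_measurable M"
    and int: "\<And>n. integrable M (\<lambda>\<omega>. (Y n \<omega>)\<^sup>2)"
    and lim: "(\<lambda>n. expectation (\<lambda>\<omega>. (Y n \<omega>)\<^sup>2)) \<longlonglongrightarrow> 0"
  shows "(\<lambda>n. expectation (\<lambda>\<omega>. min 1 \<bar>Y n \<omega>\<bar>)) \<longlonglongrightarrow> 0"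
proof (rule expectation_min_tendsto_zero)
  fix e :: real assume e: "e > 0"
  have le: "prob {\<omega>\<in>space M. \<bar>Y n \<omega>\<bar> > e} \<le> expectation (\<lambda>\<omega>. (Y n \<omega>)\<^sup>2) / e\<^sup>2" for n
  proof -
    have "prob {\<omega>\<in>space M. \<bar>Y n \<omega>\<bar> > e} \<le> prob {\<omega>\<in>space M. (Y n \<omega>)\<^sup>2 \<ge> e\<^sup>2}"
      using e by (intro finite_measure_mono) (auto simp: abs_le_square_iff[symmetric])
    also have "\<dots> \<le> expectation (\<lambda>\<omega>. (Y n \<omega>)\<^sup>2) / e\<^sup>2"
      using integral_Markov_inequality_measure[OF int[of n], where A = "{}" and c = "e\<^sup>2"] e by simp
    finally show ?thesis .
  qed
  show "(\<lambda>n. prob {\<omega>\<in>space M. \<bar>Y n \<omega>\<bar> > e}) \<longlonglongrightarrow> 0"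
  proof (rule tendsto_sandwich[OF _ _ tendsto_const])
    show "(\<lambda>n. expectation (\<lambda>\<omega>. (Y n \<omega>)\<^sup>2) / e\<^sup>2) \<longlonglongrightarrow> 0"
      using tendsto_divide[OF lim tendsto_const[of "e\<^sup>2"]] e by simp
  qed (use le in auto)
qed fact

lemma expectation_min_tendsto_zero_diff:
  fixes Y Z :: "nat \<Rightarrow> 'a \<Rightarrow> real"
  assumes [measurable]: "\<And>n. Y n \<in> borel_measurable M" "\<And>n. Z n \<in> borel_measurable M"
    and lim: "(\<lambda>n. expectation (\<lambda>\<omega>. min 1 \<bar>Y n \<omega>\<bar>)) \<longlonglongrightarrow> 0" "(\<lambda>n. expectation (\<lambda>\<omega>. min 1 \<bar>Z n \<omega>\<bar>)) \<longlonglongrightarrow> 0"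
  shows "(\<lambda>n. expectation (\<lambda>\<omega>. min 1 \<bar>Y n \<omega> - Z n \<omega>\<bar>)) \<longlonglongrightarrow> 0"
proof (rule tendsto_sandwich[OF _ _ tendsto_const])
  have i: "integrable M (\<lambda>\<omega>. min 1 \<bar>U \<omega>\<bar>)" if [measurable]: "U \<in> borel_measurable M" for U :: "'a \<Rightarrow> real"
    by (rule integrable_const_bound[where B = 1]) auto
  show "(\<lambda>n. expectation (\<lambda>\<omega>. min 1 \<bar>Y n \<omega>\<bar>) + expectation (\<lambda>\<omega>. min 1 \<bar>Z n \<omega>\<bar>)) \<longlonglongrightarrow> 0"
    using tendsto_add[OF lim] by simp
  show "\<forall>\<^sub>F n in sequentially. expectation (\<lambda>\<omega>. min 1 \<bar>Y n \<omega> - Z n \<omega>\<bar>)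
      \<le> expectation (\<lambda>\<omega>. min 1 \<bar>Y n \<omega>\<bar>) + expectation (\<lambda>\<omega>. min 1 \<bar>Z n \<omega>\<bar>)"
  proof (rule always_eventually, rule allI)
    fix n
    have "expectation (\<lambda>\<omega>. min 1 \<bar>Y n \<omega> - Z n \<omega>\<bar>) \<le> expectation (\<lambda>\<omega>. min 1 \<bar>Y n \<omega>\<bar> + min 1 \<bar>Z n \<omega>\<bar>)"
      by (intro integral_mono Bochner_Integration.integrable_add i) auto
    then show "expectation (\<lambda>\<omega>. min 1 \<bar>Y n \<omega> - Z n \<omega>\<bar>)
      \<le> expectation (\<lambda>\<omega>. min 1 \<bar>Y n \<omega>\<bar>) + expectation (\<lambda>\<omega>. min 1 \<bar>Z n \<omega>\<bar>)"
      by (subst (asm) Bochner_Integration.integral_add) (auto intro: i)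
  qed
qed (auto intro!: always_eventually integral_nonneg_AE)

lemma AE_convergent_subseq:
  fixes Y :: "nat \<Rightarrow> 'a \<Rightarrow> real"
  assumes [measurable]: "\<And>n. Y n \<in> borel_measurable M"
    and lim: "(\<lambda>n. expectation (\<lambda>\<omega>. min 1 \<bar>Y n \<omega>\<bar>)) \<longlonglongrightarrow> 0"
  shows "\<exists>r::nat\<Rightarrow>nat. strict_mono r \<and> (AE \<omega> in M. (\<lambda>n. Y (r n) \<omega>) \<longlonglongrightarrow> 0)"
proof -
  have "\<exists>r::nat\<Rightarrow>nat. strict_mono r \<and> (AE \<omega> in M. (\<lambda>n. min 1 \<bar>Y (r n) \<omega>\<bar>) \<longlonglongrightarrow> 0)"
  proof (rule tendsto_L1_AE_subseq)
    show "integrable M (\<lambda>\<omega>. min 1 \<bar>Y n \<omega>\<bar>)" for n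
      by (rule integrable_const_bound[where B = 1]) auto
    show "(\<lambda>n. expectation (\<lambda>\<omega>. norm (min 1 \<bar>Y n \<omega>\<bar>))) \<longlonglongrightarrow> 0" using lim by simp
  qed
  then obtain r :: "nat \<Rightarrow> nat" where r: "strict_mono r" "AE \<omega> in M. (\<lambda>n. min 1 \<bar>Y (r n) \<omega>\<bar>) \<longlonglongrightarrow> 0" by blast
  from r(2) have "AE \<omega> in M. (\<lambda>n. Y (r n) \<omega>) \<longlonglongrightarrow> 0"
  proof eventually_elim
    case (elim \<omega>)
    show ?case
    proof (rule tendstoI)
      fix e :: real assume "e > 0"
      \<comment> \<open>With a threshold of at most 1 the truncation is inactive, so the bound
        passes to \<open>Y\<close> itself.\<close>
      then have "\<forall>\<^sub>F n in sequentially. dist (min 1 \<bar>Y (r n) \<omega>\<bar>) 0 < min 1 e"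
        using elim by (intro tendstoD) auto
      then show "\<forall>\<^sub>F n in sequentially. dist (Y (r n) \<omega>) 0 < e"
        by eventually_elim (auto simp: min_def split: if_splits)
    qed
  qed
  with r(1) show ?thesis by blast
qed

end

text \<open>Jointly measurable because a continuous path is the limit of its dyadic step approximations.\<close>
lemma borel_measurable_continuous_process:
  fixes X :: "real \<Rightarrow> 'a \<Rightarrow> real"
  assumes meas: "\<And>t. X t \<in> borel_measurable M" and cont: "\<And>\<omega>. \<omega> \<in> space M \<Longrightarrow> continuous_on UNIV (\<lambda>t. X t \<omega>)"
  shows "(\<lambda>(\<omega>, s). X s \<omega>) \<in> borel_measurable (M \<Otimes>\<^sub>M lborel)"
proof (rule borel_measurable_LIMSEQ_metric)
  fix n :: nat
  have "(\<lambda>z. X (real_of_int i / 2 ^ n) (fst z)) \<in> borel_measurable (M \<Otimes>\<^sub>M lborel)" for i :: int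
    using meas by measurable
  moreover have "(\<lambda>z. \<lfloor>snd z * 2 ^ n :: real\<rfloor>) \<in> measurable (M \<Otimes>\<^sub>M lborel) (count_space UNIV)"
    by measurable
  ultimately have "(\<lambda>z. X (real_of_int \<lfloor>snd z * 2 ^ n :: real\<rfloor> / 2 ^ n) (fst z)) \<in> borel_measurable (M \<Otimes>\<^sub>M lborel)"
    by (rule measurable_compose_countable)
  then show "(\<lambda>(\<omega>, s). X (real_of_int \<lfloor>s * 2 ^ n :: real\<rfloor> / 2 ^ n) \<omega>) \<in> borel_measurable (M \<Otimes>\<^sub>M lborel)"
    by (simp add: split_beta')
next
  fix z assume "z \<in> space (M \<Otimes>\<^sub>M (lborel :: real measure))"
  then obtain \<omega> s where z: "z = (\<omega>, s)" "\<omega> \<in> space M" by (auto simp: space_pair_measure)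
  have "(\<lambda>n. real_of_int \<lfloor>s * 2 ^ n\<rfloor> / 2 ^ n) \<longlonglongrightarrow> s"
  proof (rule tendsto_sandwich)
    show "\<forall>\<^sub>F n in sequentially. s - (1/2) ^ n \<le> real_of_int \<lfloor>s * 2 ^ n\<rfloor> / 2 ^ n"
    proof (intro always_eventually allI)
      fix n :: nat
      have "s * 2 ^ n - 1 \<le> real_of_int \<lfloor>s * 2 ^ n\<rfloor>" by linarith
      then have "(s * 2 ^ n - 1) / 2 ^ n \<le> real_of_int \<lfloor>s * 2 ^ n\<rfloor> / 2 ^ n" by (intro divide_right_mono) auto
      then show "s - (1/2) ^ n \<le> real_of_int \<lfloor>s * 2 ^ n\<rfloor> / 2 ^ n" by (simp add: diff_divide_distrib power_one_over)
    qed
    show "\<forall>\<^sub>F n in sequentially. real_of_int \<lfloor>s * 2 ^ n\<rfloor> / 2 ^ n \<le> s"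
      by (intro always_eventually allI) (simp add: divide_le_eq)
    show "(\<lambda>n. s - (1/2) ^ n) \<longlonglongrightarrow> s"
      using tendsto_diff[OF tendsto_const[of s] LIMSEQ_power_zero[of "1/2 :: real"]] by simp
  qed auto
  moreover have "isCont (\<lambda>t. X t \<omega>) s"
    using cont[OF z(2)] by (simp add: continuous_on_eq_continuous_at)
  ultimately have "(\<lambda>n. X (real_of_int \<lfloor>s * 2 ^ n\<rfloor> / 2 ^ n) \<omega>) \<longlonglongrightarrow> X s \<omega>"
    using isCont_tendsto_compose[of s "\<lambda>t. X t \<omega>"] by blast
  then show "(\<lambda>n. case z of (\<omega>, s) \<Rightarrow> X (real_of_int \<lfloor>s * 2 ^ n\<rfloor> / 2 ^ n) \<omega>) \<longlonglongrightarrow> (case z of (\<omega>, s) \<Rightarrow> X s \<omega>)"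
    using z by simp
qed

section \<open>Equations with affine drift\<close>

text \<open>Only inequalities tie \<beta> and \<sigma> to \<open>a\<close>, so that the equations of
  X and of 1 - X are both instances although \<sigma> changes its sign under the reflection.
  Measurability is asked of the restrictions to [0,T], since the coefficients are controlled only
  there.\<close>

locale affine_drift_sde = brownian_setup +
  fixes \<beta> \<theta> \<sigma> :: "real \<Rightarrow> real" and x0 a K :: real and X :: "real \<Rightarrow> 'a \<Rightarrow> real"
  assumes T_pos: "0 < T" and a_pos: "0 < a"
    and \<beta>_meas: "(\<lambda>t. indicator {0..T} t * \<beta> t) \<in> borel_measurable borel"
    and \<theta>_meas: "(\<lambda>t. indicator {0..T} t * \<theta> t) \<in> borel_measurable borel"
    and \<beta>_bounds: "\<And>t. t \<in> {0..T} \<Longrightarrow> a \<le> \<beta> t" "\<And>t. t \<in> {0..T} \<Longrightarrow> \<beta> t \<le> K"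
    and \<theta>_bounds: "\<And>t. t \<in> {0..T} \<Longrightarrow> 0 \<le> \<theta> t" "\<And>t. t \<in> {0..T} \<Longrightarrow> \<theta> t \<le> K"
    and \<sigma>_cont: "continuous_on {0..1} \<sigma>" and \<sigma>_square: "\<And>x. x \<in> {0..1} \<Longrightarrow> (\<sigma> x)\<^sup>2 \<le> 2 * a * x"
    and x0_pos: "0 < x0"
    and sol: "strong_solution M F T W (\<lambda>t x. \<beta> t - \<theta> t * x) \<sigma> x0 X"
begin

definition "H t \<omega> = \<sigma> (X t \<omega>)"
definition "drift t \<omega> = integral {0..t} (\<lambda>s. \<beta> s - \<theta> s * X s \<omega>)"
text \<open>The stochastic integral of \<open>H\<close>, defined as the remainder of the equation so
  that decomposing X is an identity for every path. The solution property makes it the limit in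
  probability of the Ito sums, separately for each t.\<close>

definition "mart t \<omega> = X t \<omega> - x0 - drift t \<omega>"
text \<open>Continues paths as constants beyond [0,T], because joint measurability is proved for
  processes continuous on the whole line.\<close>

definition "clip t = max 0 (min T t)"

lemma clip: "clip t \<in> {0..T}" "t \<in> {0..T} \<Longrightarrow> clip t = t"
  using T_pos by (auto simp: clip_def)

lemma K_pos: "0 < K"
  using \<beta>_bounds[of 0] a_pos T_pos by auto

lemma X_adapted: "t \<in> {0..T} \<Longrightarrow> X t \<in> borel_measurable (F t)"
  using sol by (auto simp: strong_solution_def adapted_on_def)

lemma X_measurable: "t \<in> {0..T} \<Longrightarrow> X t \<in> borel_measurable M"
  using X_adapted filtration_measurable by blast

lemma X_start: "\<omega> \<in> space M \<Longrightarrow> X 0 \<omega> = x0"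
  and X_continuous: "\<omega> \<in> space M \<Longrightarrow> continuous_on {0..T} (\<lambda>t. X t \<omega>)"
  and X_range: "\<omega> \<in> space M \<Longrightarrow> t \<in> {0..T} \<Longrightarrow> X t \<omega> \<in> {0..1}"
  using sol by (auto simp: strong_solution_def)

lemma X_clip_continuous: "\<omega> \<in> space M \<Longrightarrow> continuous_on UNIV (\<lambda>t. X (clip t) \<omega>)"
  by (rule continuous_on_compose2[OF X_continuous, of _ UNIV clip])
     (use clip in \<open>auto simp: clip_def[abs_def] intro!: continuous_intros\<close>)

lemma X_clip_measurable [measurable]: "(\<lambda>(\<omega>, s). X (clip s) \<omega>) \<in> borel_measurable (M \<Otimes>\<^sub>M lborel)"
  by (rule borel_measurable_continuous_process) (use clip X_measurable X_clip_continuous in auto)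

text \<open>\<sigma> is continuous only on [0,1]. Composed with the projection onto [0,1] it is
  continuous on the line, hence Borel, and the range of X makes the projection invisible.\<close>

lemma H_adapted:
  assumes t: "t \<in> {0..T}"
  shows "H t \<in> borel_measurable (F t)"
proof -
  have sp: "space (F t) = space M" using subalgebra_filtration[of t] by (simp add: subalgebra_def)
  have "continuous_on UNIV (\<lambda>x. \<sigma> (max 0 (min 1 x)))"
    by (rule continuous_on_compose2[OF \<sigma>_cont]) (auto intro!: continuous_intros)
  then have [measurable]: "(\<lambda>x. \<sigma> (max 0 (min 1 x))) \<in> borel_measurable borel"
    by (rule borel_measurable_continuous_onI)
  have "(\<lambda>\<omega>. \<sigma> (max 0 (min 1 (X t \<omega>)))) \<in> borel_measurable (F t)"
    using measurable_compose[OF X_adapted[OF t], of "\<lambda>x. \<sigma> (max 0 (min 1 x))"] by simp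
  moreover have "H t \<omega> = \<sigma> (max 0 (min 1 (X t \<omega>)))" if "\<omega> \<in> space (F t)" for \<omega>
    using X_range[OF _ t, of \<omega>] that sp by (simp add: H_def max_absorb2 min_absorb2)
  ultimately show ?thesis by (subst measurable_cong) auto
qed

lemma H_square:
  assumes "\<omega> \<in> space M" "t \<in> {0..T}"
  shows "(H t \<omega>)\<^sup>2 \<le> 2 * a * X t \<omega>"
  unfolding H_def using \<sigma>_square X_range assms by blast

lemma H_bound:
  assumes "\<omega> \<in> space M" "t \<in> {0..T}"
  shows "\<bar>H t \<omega>\<bar> \<le> sqrt (2 * a)"
proof -
  have "(H t \<omega>)\<^sup>2 \<le> 2 * a * X t \<omega>" by (rule H_square[OF assms])
  also have "\<dots> \<le> 2 * a" using X_range[OF assms] a_pos by simp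
  finally show ?thesis using real_le_rsqrt[of "\<bar>H t \<omega>\<bar>"] by simp
qed

lemma H_continuous: "\<omega> \<in> space M \<Longrightarrow> continuous_on {0..T} (\<lambda>t. H t \<omega>)"
  unfolding H_def by (rule continuous_on_compose2[OF \<sigma>_cont X_continuous]) (use X_range in auto)

lemma drift_rate_bound:
  assumes "\<omega> \<in> space M" "t \<in> {0..T}"
  shows "\<bar>\<beta> t - \<theta> t * X t \<omega>\<bar> \<le> K" "a - K * X t \<omega> \<le> \<beta> t - \<theta> t * X t \<omega>"
proof -
  have "0 \<le> \<theta> t * X t \<omega>" "\<theta> t * X t \<omega> \<le> K" "\<theta> t * X t \<omega> \<le> K * X t \<omega>"
    using X_range[OF assms] \<theta>_bounds[OF assms(2)] K_pos mult_mono[of "\<theta> t" K "X t \<omega>" 1]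
    by (auto intro!: mult_right_mono)
  then show "\<bar>\<beta> t - \<theta> t * X t \<omega>\<bar> \<le> K" "a - K * X t \<omega> \<le> \<beta> t - \<theta> t * X t \<omega>"
    using \<beta>_bounds[OF assms(2)] a_pos by (auto simp: abs_le_iff)
qed

lemma drift_integrand_measurable:
  assumes "0 \<le> u" "v \<le> T"
  shows "(\<lambda>(\<omega>, s). indicator {u..v} s * (\<beta> s - \<theta> s * X s \<omega>)) \<in> borel_measurable (M \<Otimes>\<^sub>M lborel)"
proof -
  have [measurable]: "(\<lambda>t. indicator {0..T} t * \<beta> t) \<in> borel_measurable lborel"
    "(\<lambda>t. indicator {0..T} t * \<theta> t) \<in> borel_measurable lborel"
    using \<beta>_meas \<theta>_meas by auto
  have "(\<lambda>z. indicator {u..v} (snd z) * (indicator {0..T} (snd z) * \<beta> (snd z)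
      - (indicator {0..T} (snd z) * \<theta> (snd z)) * (case z of (\<omega>, s) \<Rightarrow> X (clip s) \<omega>)))
    \<in> borel_measurable (M \<Otimes>\<^sub>M lborel)"
    by measurable
  also have "(\<lambda>z. indicator {u..v} (snd z) * (indicator {0..T} (snd z) * \<beta> (snd z)
      - (indicator {0..T} (snd z) * \<theta> (snd z)) * (case z of (\<omega>, s) \<Rightarrow> X (clip s) \<omega>)))
    = (\<lambda>(\<omega>, s). indicator {u..v} s * (\<beta> s - \<theta> s * X s \<omega>))"
    using assms by (auto simp: fun_eq_iff indicator_def clip)
  finally show ?thesis .
qed

lemma drift_integrand_integrable:
  assumes uv: "0 \<le> u" "v \<le> T" and w: "\<omega> \<in> space M"
  shows "set_integrable lborel {u..v} (\<lambda>s. \<beta> s - \<theta> s * X s \<omega>)"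
  unfolding set_integrable_def
proof (rule integrableI_bounded_set[where A = "{u..v}" and B = K])
  show "(\<lambda>s. indicator {u..v} s *\<^sub>R (\<beta> s - \<theta> s * X s \<omega>)) \<in> borel_measurable lborel"
    using measurable_Pair2[OF drift_integrand_measurable[OF uv] w] by simp
  show "AE s in lborel. s \<in> {u..v} \<longrightarrow> norm (indicator {u..v} s *\<^sub>R (\<beta> s - \<theta> s * X s \<omega>)) \<le> K"
    using drift_rate_bound[OF w] uv by (intro AE_I2) auto
qed (auto simp: emeasure_lborel_Icc_eq)

text \<open>The equation is stated with the Henstock-Kurzweil integral; the Lebesgue form gives
  measurability in \<omega>.\<close>

lemma drift_eq:
  assumes "t \<in> {0..T}" "\<omega> \<in> space M"
  shows "drift t \<omega> = (LBINT s:{0..t}. \<beta> s - \<theta> s * X s \<omega>)"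
  using set_borel_integral_eq_integral(2)[OF drift_integrand_integrable[of 0 t \<omega>]] assms
  by (simp add: drift_def)

lemma drift_measurable:
  assumes t: "t \<in> {0..T}"
  shows "drift t \<in> borel_measurable M"
proof -
  have "(\<lambda>\<omega>. LBINT s:{0..t}. \<beta> s - \<theta> s * X s \<omega>) \<in> borel_measurable M"
    unfolding set_lebesgue_integral_def
    using lborel.borel_measurable_lebesgue_integral[OF drift_integrand_measurable[of 0 t]] t by simp
  then show ?thesis using drift_eq[OF t] by (subst measurable_cong) auto
qed

lemma mart_measurable: "t \<in> {0..T} \<Longrightarrow> mart t \<in> borel_measurable M"
  unfolding mart_def[abs_def] using X_measurable drift_measurable by measurable

lemma drift_diff:
  assumes "0 \<le> u" "u \<le> v" "v \<le> T" "\<omega> \<in> space M"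
  shows "drift v \<omega> - drift u \<omega> = (LBINT s:{u..v}. \<beta> s - \<theta> s * X s \<omega>)"
proof -
  have i: "(\<lambda>s. \<beta> s - \<theta> s * X s \<omega>) integrable_on {0..v}"
    using set_borel_integral_eq_integral(1)[OF drift_integrand_integrable[of 0 v \<omega>]] assms by simp
  have "integral {0..u} (\<lambda>s. \<beta> s - \<theta> s * X s \<omega>) + integral {u..v} (\<lambda>s. \<beta> s - \<theta> s * X s \<omega>)
      = integral {0..v} (\<lambda>s. \<beta> s - \<theta> s * X s \<omega>)"
    using assms i by (intro Henstock_Kurzweil_Integration.integral_combine) auto
  then show ?thesis
    using set_borel_integral_eq_integral(2)[OF drift_integrand_integrable[of u v \<omega>]] assms
    by (simp add: drift_def)
qed

text \<open>The crude first bound suffices for second-order terms. The second keeps \<open>a\<close>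
  exact, because \<open>a\<close> must later cancel against the quadratic variation.\<close>

lemma drift_diff_bounds:
  assumes uv: "0 \<le> u" "u \<le> v" "v \<le> T" and w: "\<omega> \<in> space M"
  shows "\<bar>drift v \<omega> - drift u \<omega>\<bar> \<le> K * (v - u)"
    "a * (v - u) - K * (LBINT s:{u..v}. X s \<omega>) \<le> drift v \<omega> - drift u \<omega>"
proof -
  have ic: "set_integrable lborel {u..v} (\<lambda>s. c)" for c :: real
    by (auto simp: set_integrable_def emeasure_lborel_Icc_eq)
  have lc: "(LBINT s:{u..v}. c) = c * (v - u)" for c :: real
    using uv by (auto simp: set_lebesgue_integral_def)
  have iX: "set_integrable lborel {u..v} (\<lambda>s. X s \<omega>)"
    by (rule borel_integrable_atLeastAtMost', rule continuous_on_subset[OF X_continuous[OF w]]) (use uv in auto)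
  note ib = drift_integrand_integrable[OF uv(1,3) w]
  have "(LBINT s:{u..v}. \<beta> s - \<theta> s * X s \<omega>) \<le> (LBINT s:{u..v}. K)"
    using drift_rate_bound[OF w] uv by (intro set_integral_mono ib ic) (auto simp: abs_le_iff)
  moreover have "- K \<le> \<beta> s - \<theta> s * X s \<omega>" if "s \<in> {u..v}" for s
    using drift_rate_bound(1)[OF w, of s] uv that by (simp add: abs_le_iff)
  then have "(LBINT s:{u..v}. - K) \<le> (LBINT s:{u..v}. \<beta> s - \<theta> s * X s \<omega>)"
    by (intro set_integral_mono ib ic)
  ultimately show "\<bar>drift v \<omega> - drift u \<omega>\<bar> \<le> K * (v - u)"
    unfolding drift_diff[OF uv w] lc by (simp add: abs_le_iff)
  have "(LBINT s:{u..v}. a - K * X s \<omega>) \<le> (LBINT s:{u..v}. \<beta> s - \<theta> s * X s \<omega>)"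
    using drift_rate_bound[OF w] uv iX by (intro set_integral_mono ib ic set_integral_diff) auto
  then show "a * (v - u) - K * (LBINT s:{u..v}. X s \<omega>) \<le> drift v \<omega> - drift u \<omega>"
    unfolding drift_diff[OF uv w] using iX by (simp add: set_integral_diff ic lc)
qed

lemma ito_sum_measurable:
  assumes "t \<in> {0..T}"
  shows "ito_sum W H t n \<in> borel_measurable M"
proof -
  have "real k * t / 2 ^ n \<in> {0..T}" if "k \<le> 2 ^ n" for k :: nat
  proof -
    have "real k \<le> 2 ^ n" using that by (metis of_nat_le_iff of_nat_numeral of_nat_power)
    then have "real k * t \<le> 2 ^ n * T" using assms by (intro mult_mono) auto
    then show ?thesis using assms by (auto simp: divide_le_eq mult.commute)
  qed
  from this[of "Suc _"] this show ?thesis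
    unfolding ito_sum_def[abs_def]
    by (intro borel_measurable_sum borel_measurable_times borel_measurable_diff)
       (auto intro!: filtration_measurable[OF H_adapted] filtration_measurable[OF brownian_adapted] simp del: of_nat_Suc)
qed

lemma ito_sum_tendsto:
  assumes t: "t \<in> {0..T}"
  shows "(\<lambda>n. expectation (\<lambda>\<omega>. min 1 \<bar>ito_sum W H t n \<omega> - mart t \<omega>\<bar>)) \<longlonglongrightarrow> 0"
proof (rule expectation_min_tendsto_zero)
  show "(\<lambda>\<omega>. ito_sum W H t n \<omega> - mart t \<omega>) \<in> borel_measurable M" for n
    using ito_sum_measurable[OF t] mart_measurable[OF t] by measurable
  have "is_ito_integral M W H t (mart t)"
    using sol t unfolding strong_solution_def H_def[abs_def] mart_def[abs_def] drift_def by auto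
  then show "(\<lambda>n. prob {\<omega> \<in> space M. \<epsilon> < \<bar>ito_sum W H t n \<omega> - mart t \<omega>\<bar>}) \<longlonglongrightarrow> 0" if "\<epsilon> > 0" for \<epsilon>
    using that unfolding is_ito_integral_def by auto
qed

end

section \<open>The martingale part along dyadic grids\<close>

text \<open>A step function with blocks of length \<open>j\<close> may be summed over unit steps:
  inside a block the increments of \<open>w\<close> telescope.\<close>

lemma sum_constant_on_blocks:
  fixes f w :: "nat \<Rightarrow> real"
  assumes "0 < j"
  shows "(\<Sum>k<n. f k * (w (Suc k * j) - w (k * j))) = (\<Sum>i<n * j. f (i div j) * (w (Suc i) - w i))"
proof -
  have "(\<Sum>i<n * j. f (i div j) * (w (Suc i) - w i))
      = (\<Sum>k<n. \<Sum>i\<in>{k * j..<k * j + j}. f (i div j) * (w (Suc i) - w i))"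
    by (rule sum.nat_group[symmetric])
  also have "\<dots> = (\<Sum>k<n. f k * (w (Suc k * j) - w (k * j)))"
  proof (rule sum.cong[OF refl])
    fix k
    have "(\<Sum>i\<in>{k * j..<k * j + j}. f (i div j) * (w (Suc i) - w i))
        = (\<Sum>i\<in>{k * j..<k * j + j}. f k * (w (Suc i) - w i))"
    proof (rule sum.cong[OF refl])
      fix i assume "i \<in> {k * j..<k * j + j}"
      then have "i div j = k" using assms by (intro div_nat_eqI) (auto simp: mult.commute)
      then show "f (i div j) * (w (Suc i) - w i) = f k * (w (Suc i) - w i)" by simp
    qed
    also have "\<dots> = f k * (w (k * j + j) - w (k * j))"
      by (simp add: sum_distrib_left[symmetric] sum_Suc_diff')
    finally show "(\<Sum>i\<in>{k * j..<k * j + j}. f (i div j) * (w (Suc i) - w i)) = f k * (w (Suc k * j) - w (k * j))"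
      by (simp add: add.commute)
  qed
  finally show ?thesis ..
qed

context affine_drift_sde
begin

definition "mesh n = T / 2 ^ n"

lemma mesh_pos: "0 < mesh n"
  using T_pos by (simp add: mesh_def)

lemma mesh_add: "mesh (m + n) * 2 ^ n = mesh m"
  by (simp add: mesh_def power_add)

lemma mesh_tendsto: "mesh \<longlonglongrightarrow> 0"
  using tendsto_mult[OF tendsto_const[of T] LIMSEQ_power_zero[of "1/2 :: real"]]
  by (simp add: mesh_def[abs_def] power_one_over field_simps)

lemma dyadic_in:
  assumes "j \<le> 2 ^ m"
  shows "real j * mesh m \<in> {0..T}"
proof -
  have "real j \<le> 2 ^ m" using assms by (metis of_nat_le_iff of_nat_numeral of_nat_power)
  then have "real j * mesh m \<le> 2 ^ m * mesh m" using mesh_pos[of m] by (intro mult_right_mono) auto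
  then show ?thesis using T_pos by (simp add: mesh_def)
qed

lemma dyadic_in_refined:
  assumes "j \<le> 2 ^ m" "i \<le> j * 2 ^ n"
  shows "real i * mesh (m + n) \<in> {0..T}"
proof (rule dyadic_in)
  have "i \<le> 2 ^ m * 2 ^ n" using assms by (meson mult_le_mono1 order_trans)
  then show "i \<le> 2 ^ (m + n)" by (simp add: power_add)
qed

text \<open>The partitions of [0,t] in the definition of the Ito integral depend on t, so they are not nested for
  different t. For t = jT/2^m they are coarsenings, by the factor j, of the dyadic partitions of [0,T], which is
  what makes increments of the martingale part accessible.\<close>
lemma ito_sum_dyadic:
  assumes "0 < j"
  shows "ito_sum W H (real j * mesh m) n \<omega>
    = transform_sum W (\<lambda>i. H (real (i div j * j) * mesh (m + n))) 0 (mesh (m + n)) (j * 2 ^ n) \<omega>"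
proof -
  have eq: "real k * (real j * mesh m) / 2 ^ n = real (k * j) * mesh (m + n)" for k
    by (simp add: mesh_def power_add)
  show ?thesis
    unfolding ito_sum_def transform_sum_def eq
    using sum_constant_on_blocks[OF assms, where n = "2 ^ n" and f = "\<lambda>k. H (real (k * j) * mesh (m + n)) \<omega>"
       and w = "\<lambda>i. W (real i * mesh (m + n)) \<omega>"]
    by (simp add: mult.commute[of j])
qed

text \<open>Pathwise uniform continuity of \<open>H\<close>: the point at which the coarse integrand
  is frozen lies within \<open>j\<close> fine steps of the current one, and this distance shrinks
  with the mesh.\<close>

lemma dyadic_oscillation_tendsto:
  assumes j: "0 < j" "j \<le> 2 ^ m" and w: "\<omega> \<in> space M"
  shows "(\<lambda>n. mesh (m + n) * (\<Sum>i<j * 2 ^ n. (H (real i * mesh (m + n)) \<omega> - H (real (i div j * j) * mesh (m + n)) \<omega>)\<^sup>2)) \<longlonglongrightarrow> 0"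
proof (rule tendstoI)
  fix e :: real assume e: "e > 0"
  \<comment> \<open>Chosen so that the total, at most \<open>T * e'\<^sup>2\<close>, equals e /
    2.\<close>
  define e' where "e' = sqrt (e / (2 * T))"
  have e': "e' > 0" "e'\<^sup>2 = e / (2 * T)" using e T_pos by (auto simp: e'_def)
  have "uniformly_continuous_on {0..T} (\<lambda>t. H t \<omega>)"
    by (rule compact_uniformly_continuous[OF H_continuous[OF w]]) auto
  then obtain d where d: "d > 0" "\<And>s t. s \<in> {0..T} \<Longrightarrow> t \<in> {0..T} \<Longrightarrow> dist t s < d \<Longrightarrow> dist (H t \<omega>) (H s \<omega>) < e'"
    using e' unfolding uniformly_continuous_on_def by metis
  have "(\<lambda>n. mesh (n + m)) \<longlonglongrightarrow> 0" by (rule LIMSEQ_ignore_initial_segment[OF mesh_tendsto])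
  then have "\<forall>\<^sub>F n in sequentially. dist (mesh (n + m)) 0 < d / real j"
    using d j by (intro tendstoD) auto
  then show "\<forall>\<^sub>F n in sequentially. dist (mesh (m + n) * (\<Sum>i<j * 2 ^ n. (H (real i * mesh (m + n)) \<omega> - H (real (i div j * j) * mesh (m + n)) \<omega>)\<^sup>2)) 0 < e"
  proof eventually_elim
    case (elim n)
    then have small: "real j * mesh (m + n) < d"
      using mesh_pos[of "m + n"] j by (simp add: field_simps add.commute)
    have "(\<Sum>i<j * 2 ^ n. (H (real i * mesh (m + n)) \<omega> - H (real (i div j * j) * mesh (m + n)) \<omega>)\<^sup>2) \<le> (\<Sum>i<j * 2 ^ n. e'\<^sup>2)"
    proof (rule sum_mono)
      fix i assume i: "i \<in> {..<j * 2 ^ n}"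
      have le: "i div j * j \<le> i" by simp
      have "real i - real (i div j * j) = real (i mod j)"
        using of_nat_diff[OF le] by (metis minus_div_mult_eq_mod)
      then have "dist (real i * mesh (m + n)) (real (i div j * j) * mesh (m + n)) = real (i mod j) * mesh (m + n)"
        using mesh_pos[of "m + n"] by (simp only: dist_real_def left_diff_distrib[symmetric]) (simp add: abs_mult)
      also have "\<dots> \<le> real j * mesh (m + n)"
        using mesh_pos[of "m + n"] j by (intro mult_right_mono) (auto simp: less_imp_le)
      finally have "dist (real i * mesh (m + n)) (real (i div j * j) * mesh (m + n)) < d" using small by simp
      then have "dist (H (real i * mesh (m + n)) \<omega>) (H (real (i div j * j) * mesh (m + n)) \<omega>) < e'"
        using i order_trans[OF le, of "j * 2 ^ n"] j by (intro d dyadic_in_refined[of j]) (auto simp del: of_nat_mult mult_le_cancel2)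
      then have "\<bar>H (real i * mesh (m + n)) \<omega> - H (real (i div j * j) * mesh (m + n)) \<omega>\<bar>\<^sup>2 \<le> e'\<^sup>2"
        by (intro power_mono) (auto simp: dist_real_def)
      then show "(H (real i * mesh (m + n)) \<omega> - H (real (i div j * j) * mesh (m + n)) \<omega>)\<^sup>2 \<le> e'\<^sup>2" by simp
    qed
    then have "mesh (m + n) * (\<Sum>i<j * 2 ^ n. (H (real i * mesh (m + n)) \<omega> - H (real (i div j * j) * mesh (m + n)) \<omega>)\<^sup>2)
        \<le> mesh (m + n) * (\<Sum>i<j * 2 ^ n. e'\<^sup>2)"
      using mesh_pos[of "m + n"] by (intro mult_left_mono) auto
    also have "\<dots> = real (j * 2 ^ n) * mesh (m + n) * e'\<^sup>2" by simp
    also have "\<dots> \<le> T * e'\<^sup>2"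
      using dyadic_in_refined[OF j(2) order_refl] by (intro mult_right_mono) auto
    also have "\<dots> < e" using e T_pos by (simp add: e'(2))
    finally show ?case
      using mesh_pos[of "m + n"] by (simp add: abs_mult sum_nonneg)
  qed
qed

lemma dyadic_transform:
  assumes j: "j2 \<le> 2 ^ m" "j1 \<le> j2"
  shows "martingale_transform M F T W (\<lambda>i. H (real j1 * mesh m + real i * mesh (m + n)))
    (real j1 * mesh m) (mesh (m + n)) (sqrt (2 * a)) ((j2 - j1) * 2 ^ n)"
proof -
  have in_T: "real j1 * mesh m + real i * mesh (m + n) \<in> {0..T}" if "i \<le> (j2 - j1) * 2 ^ n" for i
  proof -
    have eq: "real j1 * mesh m + real i * mesh (m + n) = real (j1 * 2 ^ n + i) * mesh (m + n)"
      by (simp add: mesh_add[symmetric, of m n] algebra_simps)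
    have "j1 * 2 ^ n + i \<le> j1 * 2 ^ n + (j2 - j1) * 2 ^ n" using that by simp
    also have "\<dots> = j2 * 2 ^ n" using j by (simp flip: add_mult_distrib)
    finally show ?thesis unfolding eq by (intro dyadic_in_refined[OF j(1)])
  qed
  show ?thesis
  proof unfold_locales
    show "0 \<le> real j1 * mesh m" "0 < mesh (m + n)" using mesh_pos[of m] mesh_pos[of "m + n"] by simp_all
    show "real j1 * mesh m + real ((j2 - j1) * 2 ^ n) * mesh (m + n) \<le> T"
      using in_T[OF order_refl] by simp
  qed (use in_T in \<open>auto intro!: H_adapted H_bound\<close>)
qed

text \<open>Replaces the integrand frozen on blocks of length \<open>j\<close> by its values on the
  fine grid. The difference is again a martingale transform, and by the isometry its second moment
  is the expected oscillation, which vanishes by dominated convergence. Afterwards the sums for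
  different \<open>j\<close> share one grid and can be subtracted.\<close>

lemma transform_sum_tendsto:
  assumes j: "j \<le> 2 ^ m"
  shows "(\<lambda>n. expectation (\<lambda>\<omega>. min 1 \<bar>transform_sum W (\<lambda>i. H (real i * mesh (m + n))) 0 (mesh (m + n)) (j * 2 ^ n) \<omega>
      - mart (real j * mesh m) \<omega>\<bar>)) \<longlonglongrightarrow> 0"
\<comment> \<open>The description of the Ito sum by blocks divides by \<open>j\<close>, so time 0 is
  treated apart.\<close>
proof (cases "j = 0")
  case True
  have "expectation (\<lambda>\<omega>. min 1 \<bar>transform_sum W (\<lambda>i. H (real i * mesh (m + n))) 0 (mesh (m + n)) (j * 2 ^ n) \<omega>
      - mart (real j * mesh m) \<omega>\<bar>) = expectation (\<lambda>\<omega>. 0)" for n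
    using True X_start by (intro Bochner_Integration.integral_cong) (auto simp: transform_sum_def mart_def drift_def)
  then show ?thesis by simp
next
  case False
  then have j0: "0 < j" by simp
  let ?P = "\<lambda>n. transform_sum W (\<lambda>i. H (real i * mesh (m + n))) 0 (mesh (m + n)) (j * 2 ^ n)"
  let ?I = "\<lambda>n. ito_sum W H (real j * mesh m) n"
  let ?G = "\<lambda>n i \<omega>. H (real (i div j * j) * mesh (m + n)) \<omega> - H (real i * mesh (m + n)) \<omega>"
  let ?D = "\<lambda>n. transform_sum W (?G n) 0 (mesh (m + n)) (j * 2 ^ n)"
  have div_le: "i div j * j \<le> j * 2 ^ n" if "i < j * 2 ^ n" for i n
    using that by (metis div_times_less_eq_dividend less_imp_le order_trans)
  have bnd: "\<bar>?G n i \<omega>\<bar> \<le> 2 * sqrt (2 * a)" if "i < j * 2 ^ n" "\<omega> \<in> space M" for n i \<omega>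
    using H_bound[OF that(2) dyadic_in_refined[OF j, of i n]]
      H_bound[OF that(2) dyadic_in_refined[OF j, of "i div j * j" n]] that div_le[OF that(1)] by simp
  have trans: "martingale_transform M F T W (?G n) 0 (mesh (m + n)) (2 * sqrt (2 * a)) (j * 2 ^ n)" for n
  proof unfold_locales
    show "?G n i \<in> borel_measurable (F (0 + real i * mesh (m + n)))" if i: "i < j * 2 ^ n" for i
    proof (intro borel_measurable_diff)
      show "H (real i * mesh (m + n)) \<in> borel_measurable (F (0 + real i * mesh (m + n)))"
        using dyadic_in_refined[OF j, of i n] i by (auto intro: H_adapted)
      have "real (i div j * j) * mesh (m + n) \<le> 0 + real i * mesh (m + n)"
        using mesh_pos[of "m + n"] by (simp only: add_0_left) (intro mult_right_mono, auto simp del: of_nat_mult)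
      then show "H (real (i div j * j) * mesh (m + n)) \<in> borel_measurable (F (0 + real i * mesh (m + n)))"
        using dyadic_in_refined[OF j, of "i div j * j" n] div_le[OF i]
        by (intro filtration_measurable_mono[OF H_adapted]) auto
    qed
    show "0 + real (j * 2 ^ n) * mesh (m + n) \<le> T"
      using dyadic_in_refined[OF j order_refl] by simp
  qed (use mesh_pos bnd in auto)
  have Deq: "?D n \<omega> = ?I n \<omega> - ?P n \<omega>" for n \<omega>
    unfolding ito_sum_dyadic[OF j0] transform_sum_def by (simp only: left_diff_distrib sum_subtractf)
  have [measurable]: "?I n \<in> borel_measurable M" "mart (real j * mesh m) \<in> borel_measurable M" for n
    using dyadic_in[OF j] by (auto intro: ito_sum_measurable mart_measurable)
  have Dm: "?D n \<in> borel_measurable M" for n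
    by (rule martingale_transform.S_measurable[OF trans order_refl])
  have [measurable]: "?P n \<in> borel_measurable M" for n
    using martingale_transform.S_measurable[OF dyadic_transform[OF j, of 0 n] order_refl] by simp
  have sq: "expectation (\<lambda>\<omega>. ?D n \<omega> ^ 2) = expectation (\<lambda>\<omega>. mesh (m + n) * (\<Sum>i<j * 2 ^ n. (H (real i * mesh (m + n)) \<omega> - H (real (i div j * j) * mesh (m + n)) \<omega>)\<^sup>2))" for n
  proof -
    have int: "integrable M (\<lambda>\<omega>. (?G n i \<omega>)\<^sup>2)" if i: "i < j * 2 ^ n" for i
    proof (rule integrable_const_bound[where B = "(2 * sqrt (2 * a))\<^sup>2"])
      show "AE \<omega> in M. norm ((?G n i \<omega>)\<^sup>2) \<le> (2 * sqrt (2 * a))\<^sup>2"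
        using power_mono[OF bnd[OF i], of _ 2] by (intro AE_I2) simp
      have [measurable]: "?G n i \<in> borel_measurable M"
        by (rule martingale_transform.G_measurable[OF trans i])
      show "(\<lambda>\<omega>. (?G n i \<omega>)\<^sup>2) \<in> borel_measurable M" by measurable
    qed
    have "expectation (\<lambda>\<omega>. ?D n \<omega> ^ 2) = mesh (m + n) * (\<Sum>i<j * 2 ^ n. expectation (\<lambda>\<omega>. (?G n i \<omega>)\<^sup>2))"
      using martingale_transform.expectation_S_square[OF trans, where Z = "\<lambda>_. 1" and C = 1, of "j * 2 ^ n" n] by simp
    also have "\<dots> = expectation (\<lambda>\<omega>. mesh (m + n) * (\<Sum>i<j * 2 ^ n. (?G n i \<omega>)\<^sup>2))"
      using int by (subst integral_mult_right_zero, subst Bochner_Integration.integral_sum) auto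
    finally show ?thesis by (simp add: power2_commute)
  qed
  have "(\<lambda>n. expectation (\<lambda>\<omega>. ?D n \<omega> ^ 2)) \<longlonglongrightarrow> expectation (\<lambda>_. 0)"
    unfolding sq
  \<comment> \<open>Each squared difference is at most \<open>(2 * sqrt (2 * a))\<^sup>2\<close>,
    and the step lengths add up to at most T.\<close>
  proof (rule integral_dominated_convergence[where w = "\<lambda>_. T * (2 * sqrt (2 * a))\<^sup>2"])
    fix n
    have Gm: "(\<lambda>\<omega>. (H (real i * mesh (m + n)) \<omega> - H (real (i div j * j) * mesh (m + n)) \<omega>)\<^sup>2) \<in> borel_measurable M"
      if "i < j * 2 ^ n" for i
      using borel_measurable_power[OF martingale_transform.G_measurable[OF trans that], of 2] by (simp add: power2_commute)
    show "(\<lambda>\<omega>. mesh (m + n) * (\<Sum>i<j * 2 ^ n. (H (real i * mesh (m + n)) \<omega> - H (real (i div j * j) * mesh (m + n)) \<omega>)\<^sup>2)) \<in> borel_measurable M"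
      by (intro borel_measurable_times borel_measurable_sum borel_measurable_const Gm) simp
    show "AE \<omega> in M. norm (mesh (m + n) * (\<Sum>i<j * 2 ^ n. (H (real i * mesh (m + n)) \<omega> - H (real (i div j * j) * mesh (m + n)) \<omega>)\<^sup>2)) \<le> T * (2 * sqrt (2 * a))\<^sup>2"
    proof (rule AE_I2)
      fix \<omega> assume w: "\<omega> \<in> space M"
      have "(\<Sum>i<j * 2 ^ n. (?G n i \<omega>)\<^sup>2) \<le> (\<Sum>i<j * 2 ^ n. (2 * sqrt (2 * a))\<^sup>2)"
        using power_mono[OF bnd[OF _ w], of _ n 2] by (intro sum_mono) simp
      then have "mesh (m + n) * (\<Sum>i<j * 2 ^ n. (?G n i \<omega>)\<^sup>2) \<le> mesh (m + n) * (\<Sum>i<j * 2 ^ n. (2 * sqrt (2 * a))\<^sup>2)"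
        using mesh_pos[of "m + n"] by (intro mult_left_mono) auto
      also have "\<dots> = real (j * 2 ^ n) * mesh (m + n) * (2 * sqrt (2 * a))\<^sup>2" by simp
      also have "\<dots> \<le> T * (2 * sqrt (2 * a))\<^sup>2"
        using dyadic_in_refined[OF j order_refl] by (intro mult_right_mono) auto
      finally show "norm (mesh (m + n) * (\<Sum>i<j * 2 ^ n. (H (real i * mesh (m + n)) \<omega> - H (real (i div j * j) * mesh (m + n)) \<omega>)\<^sup>2)) \<le> T * (2 * sqrt (2 * a))\<^sup>2"
        using mesh_pos[of "m + n"] by (simp add: abs_mult sum_nonneg power2_commute)
    qed
  qed (use dyadic_oscillation_tendsto[OF j0 j] in auto)
  moreover have "integrable M (\<lambda>\<omega>. (?D n \<omega>)\<^sup>2)" for n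
    using martingale_transform.S_integrable[OF trans order_refl, of 2 "\<lambda>_. 1" 1 n] by simp
  ultimately have "(\<lambda>n. expectation (\<lambda>\<omega>. min 1 \<bar>?D n \<omega>\<bar>)) \<longlonglongrightarrow> 0"
    by (intro expectation_min_tendsto_zero_L2 Dm) auto
  from expectation_min_tendsto_zero_diff[OF _ Dm ito_sum_tendsto[OF dyadic_in[OF j]] this]
  have "(\<lambda>n. expectation (\<lambda>\<omega>. min 1 \<bar>(?I n \<omega> - mart (real j * mesh m) \<omega>) - ?D n \<omega>\<bar>)) \<longlonglongrightarrow> 0"
    by simp
  then show ?thesis unfolding Deq by (simp add: algebra_simps)
qed

text \<open>Approximates the increment of \<open>mart\<close> between two points of grid m by sums
  on grid m + n. It starts at the left point, so weights known at that time are admissible.\<close>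

definition "level_sum m j1 j2 n =
  transform_sum W (\<lambda>i. H (real j1 * mesh m + real i * mesh (m + n))) (real j1 * mesh m) (mesh (m + n)) ((j2 - j1) * 2 ^ n)"

text \<open>This is where additivity of the stochastic integral in time comes from: the level sum is
  a difference of two sums from time 0 on the same fine grid, each converging in
  probability.\<close>

lemma level_sum_AE_subseq:
  assumes j: "j2 \<le> 2 ^ m" "j1 \<le> j2"
  shows "\<exists>r::nat\<Rightarrow>nat. strict_mono r \<and>
    (AE \<omega> in M. (\<lambda>n. level_sum m j1 j2 (r n) \<omega>) \<longlonglongrightarrow> mart (real j2 * mesh m) \<omega> - mart (real j1 * mesh m) \<omega>)"
proof -
  have j1: "j1 \<le> 2 ^ m" using j by simp
  let ?P = "\<lambda>j n. transform_sum W (\<lambda>i. H (real i * mesh (m + n))) 0 (mesh (m + n)) (j * 2 ^ n)"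
  have eq: "level_sum m j1 j2 n \<omega> = ?P j2 n \<omega> - ?P j1 n \<omega>" for n \<omega>
  proof -
    let ?f = "\<lambda>i. H (real i * mesh (m + n)) \<omega> * (W (real (Suc i) * mesh (m + n)) \<omega> - W (real i * mesh (m + n)) \<omega>)"
    have split: "(\<Sum>i<p + q. f i) = (\<Sum>i<p. f i) + (\<Sum>i<q. f (p + i))" for p q :: nat and f :: "nat \<Rightarrow> real"
      by (induction q) auto
    have idx: "real j1 * mesh m + real i * mesh (m + n) = real (j1 * 2 ^ n + i) * mesh (m + n)" for i
      by (simp add: mesh_add[symmetric, of m n] algebra_simps)
    have "j2 * 2 ^ n = j1 * 2 ^ n + (j2 - j1) * 2 ^ n" using j by (simp flip: add_mult_distrib)
    then have "(\<Sum>i<j2 * 2 ^ n. ?f i) = (\<Sum>i<j1 * 2 ^ n. ?f i) + (\<Sum>i<(j2 - j1) * 2 ^ n. ?f (j1 * 2 ^ n + i))"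
      by (simp only: split)
    then show ?thesis unfolding level_sum_def transform_sum_def idx by simp
  qed
  have [measurable]: "?P j n \<in> borel_measurable M" if "j \<le> 2 ^ m" for j n
    using martingale_transform.S_measurable[OF dyadic_transform[OF that, of 0 n] order_refl] by simp
  have [measurable]: "mart (real j2 * mesh m) \<in> borel_measurable M" "mart (real j1 * mesh m) \<in> borel_measurable M"
    using dyadic_in[OF j(1)] dyadic_in[OF j1] by (auto intro: mart_measurable)
  note [measurable] = \<open>\<And>j n. j \<le> 2 ^ m \<Longrightarrow> ?P j n \<in> borel_measurable M\<close>[OF j(1)] 
    \<open>\<And>j n. j \<le> 2 ^ m \<Longrightarrow> ?P j n \<in> borel_measurable M\<close>[OF j1]
  let ?Y = "\<lambda>n \<omega>. (?P j2 n \<omega> - mart (real j2 * mesh m) \<omega>) - (?P j1 n \<omega> - mart (real j1 * mesh m) \<omega>)"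
  have "(\<lambda>n. expectation (\<lambda>\<omega>. min 1 \<bar>?Y n \<omega>\<bar>)) \<longlonglongrightarrow> 0"
    by (rule expectation_min_tendsto_zero_diff[OF _ _ transform_sum_tendsto[OF j(1)] transform_sum_tendsto[OF j1]])
       measurable
  then obtain r :: "nat \<Rightarrow> nat" where r: "strict_mono r" "AE \<omega> in M. (\<lambda>n. ?Y (r n) \<omega>) \<longlonglongrightarrow> 0"
    using AE_convergent_subseq[of ?Y] by auto
  from r(2) have "AE \<omega> in M. (\<lambda>n. level_sum m j1 j2 (r n) \<omega>) \<longlonglongrightarrow> mart (real j2 * mesh m) \<omega> - mart (real j1 * mesh m) \<omega>"
  proof eventually_elim
    case (elim \<omega>)
    then have "(\<lambda>n. ?Y (r n) \<omega> + (mart (real j2 * mesh m) \<omega> - mart (real j1 * mesh m) \<omega>))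
        \<longlonglongrightarrow> 0 + (mart (real j2 * mesh m) \<omega> - mart (real j1 * mesh m) \<omega>)"
      by (intro tendsto_add tendsto_const)
    then show ?case unfolding eq by (simp add: algebra_simps)
  qed
  with r(1) show ?thesis by blast
qed

end

section \<open>Limits of moment bounds: increments of \<open>mart\<close> and of
  \<open>X\<close>\<close>

lemma integrable_Fatou:
  fixes f :: "nat \<Rightarrow> 'a \<Rightarrow> real"
  assumes meas: "f' \<in> borel_measurable M" and int: "\<And>n. integrable M (f n)"
    and nonneg: "\<And>n \<omega>. \<omega> \<in> space M \<Longrightarrow> 0 \<le> f n \<omega>" "\<And>\<omega>. \<omega> \<in> space M \<Longrightarrow> 0 \<le> f' \<omega>"
    and lim: "AE \<omega> in M. (\<lambda>n. f n \<omega>) \<longlonglongrightarrow> f' \<omega>" and bound: "\<And>n. integral\<^sup>L M (f n) \<le> B"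
  shows "integrable M f'" "integral\<^sup>L M f' \<le> B"
proof -
  have "(\<integral>\<^sup>+\<omega>. ennreal (f' \<omega>) \<partial>M) = (\<integral>\<^sup>+\<omega>. liminf (\<lambda>n. ennreal (f n \<omega>)) \<partial>M)"
  proof (rule nn_integral_cong_AE)
    from lim show "AE \<omega> in M. ennreal (f' \<omega>) = liminf (\<lambda>n. ennreal (f n \<omega>))"
    proof eventually_elim
      case (elim \<omega>)
      then have "(\<lambda>n. ennreal (f n \<omega>)) \<longlonglongrightarrow> ennreal (f' \<omega>)" by (rule tendsto_ennrealI)
      then show ?case using lim_imp_Liminf[OF sequentially_bot] by metis
    qed
  qed
  also have "\<dots> \<le> liminf (\<lambda>n. \<integral>\<^sup>+\<omega>. ennreal (f n \<omega>) \<partial>M)"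
    using int by (intro nn_integral_liminf) auto
  also have "\<dots> = liminf (\<lambda>n. ennreal (integral\<^sup>L M (f n)))"
    using int nonneg by (simp add: nn_integral_eq_integral)
  also have "\<dots> \<le> liminf (\<lambda>n::nat. ennreal B)"
    using bound by (intro Liminf_mono always_eventually allI ennreal_leI)
  also have "\<dots> = ennreal B" by (simp add: Liminf_const)
  finally have le: "(\<integral>\<^sup>+\<omega>. ennreal (f' \<omega>) \<partial>M) \<le> ennreal B" .
  then show i: "integrable M f'"
    using meas nonneg by (intro integrableI_nonneg) (auto intro: le_less_trans)
  \<comment> \<open>\<open>ennreal\<close> cuts negative numbers off at 0, so the bound returns to
    the reals only once \<open>B\<close> is known to be nonnegative.\<close>
  have "0 \<le> integral\<^sup>L M (f 0)" using nonneg by (intro integral_nonneg_AE) auto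
  then have "0 \<le> B" using bound[of 0] by simp
  with le i nonneg show "integral\<^sup>L M f' \<le> B"
    by (simp add: nn_integral_eq_integral)
qed

context affine_drift_sde
begin

text \<open>The bound for transforms does not depend on the fineness n and survives Fatou along the
  subsequence; 12 a^2 = 3 (sqrt (2 a))^4.\<close>

lemma mart_diff_power4:
  assumes j: "j2 \<le> 2 ^ m" "j1 \<le> j2"
  shows "integrable M (\<lambda>\<omega>. (mart (real j2 * mesh m) \<omega> - mart (real j1 * mesh m) \<omega>) ^ 4)" (is ?int)
    and "expectation (\<lambda>\<omega>. (mart (real j2 * mesh m) \<omega> - mart (real j1 * mesh m) \<omega>) ^ 4)
      \<le> 12 * a\<^sup>2 * (real j2 * mesh m - real j1 * mesh m)\<^sup>2" (is ?le)
proof -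
  have j1: "j1 \<le> 2 ^ m" using j by simp
  obtain r :: "nat \<Rightarrow> nat" where r: "AE \<omega> in M. (\<lambda>n. level_sum m j1 j2 (r n) \<omega>) \<longlonglongrightarrow> mart (real j2 * mesh m) \<omega> - mart (real j1 * mesh m) \<omega>"
    using level_sum_AE_subseq[OF j] by blast
  have [measurable]: "mart (real j2 * mesh m) \<in> borel_measurable M" "mart (real j1 * mesh m) \<in> borel_measurable M"
    using dyadic_in[OF j(1)] dyadic_in[OF j1] by (auto intro: mart_measurable)
  have len: "real ((j2 - j1) * 2 ^ n) * mesh (m + n) = real j2 * mesh m - real j1 * mesh m" for n
    using j mesh_add[of m n] by (simp add: of_nat_diff algebra_simps)
  have c4: "sqrt (2 * a) ^ 4 = 4 * a\<^sup>2"
  proof -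
    have "sqrt (2 * a) ^ 4 = ((sqrt (2 * a))\<^sup>2)\<^sup>2" by (simp flip: power_mult)
    then show ?thesis using a_pos by (simp add: power_mult_distrib)
  qed
  have "integrable M (\<lambda>\<omega>. (level_sum m j1 j2 n \<omega>) ^ 4)"
    "expectation (\<lambda>\<omega>. (level_sum m j1 j2 n \<omega>) ^ 4) \<le> 12 * a\<^sup>2 * (real j2 * mesh m - real j1 * mesh m)\<^sup>2" for n
    using martingale_transform.S_power4_integrable[OF dyadic_transform[OF j, of n] order_refl]
      martingale_transform.expectation_S_power4_le[OF dyadic_transform[OF j, of n] order_refl]
    unfolding level_sum_def len c4 by simp_all
  moreover have "AE \<omega> in M. (\<lambda>n. level_sum m j1 j2 (r n) \<omega> ^ 4) \<longlonglongrightarrow> (mart (real j2 * mesh m) \<omega> - mart (real j1 * mesh m) \<omega>) ^ 4"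
    using r by eventually_elim (intro tendsto_power)
  ultimately show ?int ?le
    using integrable_Fatou[where f = "\<lambda>n \<omega>. level_sum m j1 j2 (r n) \<omega> ^ 4" and M = M
      and f' = "\<lambda>\<omega>. (mart (real j2 * mesh m) \<omega> - mart (real j1 * mesh m) \<omega>) ^ 4"
      and B = "12 * a\<^sup>2 * (real j2 * mesh m - real j1 * mesh m)\<^sup>2"] by auto
qed

text \<open>The constant in E (X t - X s)^4 <= L4 (t - s)^2. The 8 comes from splitting into
  martingale and drift, \<open>12 * a\<^sup>2\<close> from the martingale, and the drift gives (K (t
  - s))^4 <= K^4 T^2 (t - s)^2.\<close>

definition "L4 = 8 * (12 * a\<^sup>2 + K ^ 4 * T\<^sup>2)"

lemma L4_nonneg: "0 \<le> L4"
  by (simp add: L4_def)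

lemma X_diff_bound:
  assumes "\<omega> \<in> space M" "s \<in> {0..T}" "t \<in> {0..T}"
  shows "\<bar>X t \<omega> - X s \<omega>\<bar> \<le> 1"
  using X_range[OF assms(1,2)] X_range[OF assms(1,3)] by auto

lemma X_diff_power4_integrable:
  assumes "s \<in> {0..T}" "t \<in> {0..T}"
  shows "integrable M (\<lambda>\<omega>. (X t \<omega> - X s \<omega>) ^ 4)"
proof (rule integrable_const_bound[where B = 1])
  show "AE \<omega> in M. norm ((X t \<omega> - X s \<omega>) ^ 4) \<le> 1"
    using power_mono[OF X_diff_bound[OF _ assms], of _ 4] by (intro AE_I2) (simp add: power_abs)
qed (use X_measurable assms in auto)

lemma X_diff_power4_dyadic:
  assumes j: "j2 \<le> 2 ^ m" "j1 \<le> j2"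
  shows "expectation (\<lambda>\<omega>. (X (real j2 * mesh m) \<omega> - X (real j1 * mesh m) \<omega>) ^ 4)
    \<le> L4 * (real j2 * mesh m - real j1 * mesh m)\<^sup>2"
proof -
  define s where "s = real j1 * mesh m"
  define t where "t = real j2 * mesh m"
  have j1: "j1 \<le> 2 ^ m" using j by simp
  have st: "0 \<le> s" "s \<le> t" "t \<le> T"
    using dyadic_in[OF j1] dyadic_in[OF j(1)] j mesh_pos[of m] by (auto simp: s_def t_def)
  have inT: "s \<in> {0..T}" "t \<in> {0..T}" using st by auto
  have "expectation (\<lambda>\<omega>. (X t \<omega> - X s \<omega>) ^ 4) \<le> expectation (\<lambda>\<omega>. 8 * ((mart t \<omega> - mart s \<omega>) ^ 4 + (K * (t - s)) ^ 4))"
  proof (rule integral_mono)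
    show "integrable M (\<lambda>\<omega>. 8 * ((mart t \<omega> - mart s \<omega>) ^ 4 + (K * (t - s)) ^ 4))"
      using mart_diff_power4(1)[OF j] by (auto simp: s_def t_def)
    fix \<omega> assume w: "\<omega> \<in> space M"
    have "(X t \<omega> - X s \<omega>) ^ 4 = ((mart t \<omega> - mart s \<omega>) + (drift t \<omega> - drift s \<omega>)) ^ 4" by (simp add: mart_def)
    also have "\<dots> \<le> 8 * ((mart t \<omega> - mart s \<omega>) ^ 4 + (drift t \<omega> - drift s \<omega>) ^ 4)" by (rule power4_add_le)
    also have "(drift t \<omega> - drift s \<omega>) ^ 4 \<le> (K * (t - s)) ^ 4"
      using power_mono[OF drift_diff_bounds(1)[OF st w], of 4] by simp
    finally show "(X t \<omega> - X s \<omega>) ^ 4 \<le> 8 * ((mart t \<omega> - mart s \<omega>) ^ 4 + (K * (t - s)) ^ 4)" by simp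
  qed (rule X_diff_power4_integrable[OF inT])
  also have "\<dots> = 8 * (expectation (\<lambda>\<omega>. (mart t \<omega> - mart s \<omega>) ^ 4) + (K * (t - s)) ^ 4)"
    using mart_diff_power4(1)[OF j] by (simp add: s_def t_def prob_space)
  also have "\<dots> \<le> 8 * (12 * a\<^sup>2 * (t - s)\<^sup>2 + K ^ 4 * T\<^sup>2 * (t - s)\<^sup>2)"
  proof -
    have "expectation (\<lambda>\<omega>. (mart t \<omega> - mart s \<omega>) ^ 4) \<le> 12 * a\<^sup>2 * (t - s)\<^sup>2"
      using mart_diff_power4(2)[OF j] by (simp add: s_def t_def)
    moreover have "(K * (t - s)) ^ 4 \<le> K ^ 4 * T\<^sup>2 * (t - s)\<^sup>2"
    proof -
      have "(t - s)\<^sup>2 \<le> T\<^sup>2" using st by (intro power_mono) auto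
      then have "K ^ 4 * (t - s)\<^sup>2 * (t - s)\<^sup>2 \<le> K ^ 4 * T\<^sup>2 * (t - s)\<^sup>2"
        by (intro mult_right_mono mult_left_mono) auto
      then show ?thesis by (simp add: power_mult_distrib power4_eq_xxxx power2_eq_square algebra_simps)
    qed
    ultimately show ?thesis by simp
  qed
  also have "\<dots> = L4 * (t - s)\<^sup>2" by (simp add: L4_def algebra_simps)
  finally show ?thesis by (simp add: s_def t_def)
qed

definition "floor_idx n t = nat \<lfloor>t / mesh n\<rfloor>"

lemma floor_idx:
  assumes t: "t \<in> {0..T}"
  shows "floor_idx n t \<le> 2 ^ n" "real (floor_idx n t) * mesh n \<le> t" "t - mesh n \<le> real (floor_idx n t) * mesh n"
proof -
  have "t / mesh n \<le> 2 ^ n" using t T_pos by (simp add: mesh_def divide_le_eq)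
  then have "\<lfloor>t / mesh n\<rfloor> \<le> \<lfloor>2 ^ n :: real\<rfloor>" by (rule floor_mono)
  also have "\<lfloor>2 ^ n :: real\<rfloor> = 2 ^ n" by (metis floor_of_int of_int_numeral of_int_power)
  finally show "floor_idx n t \<le> 2 ^ n" by (simp add: floor_idx_def nat_le_iff)
  have nn: "0 \<le> t / mesh n" using t mesh_pos[of n] by auto
  then have eq: "real (floor_idx n t) = real_of_int \<lfloor>t / mesh n\<rfloor>" by (simp add: floor_idx_def)
  have "real (floor_idx n t) \<le> t / mesh n" unfolding eq by simp
  then show "real (floor_idx n t) * mesh n \<le> t" using mesh_pos[of n] by (simp add: pos_le_divide_eq)
  have "t / mesh n - 1 \<le> real (floor_idx n t)" unfolding eq by linarith
  then have "(t / mesh n - 1) * mesh n \<le> real (floor_idx n t) * mesh n" using mesh_pos[of n] by (intro mult_right_mono) auto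
  then show "t - mesh n \<le> real (floor_idx n t) * mesh n" using mesh_pos[of n] by (simp add: left_diff_distrib)
qed

lemma floor_idx_tendsto:
  assumes t: "t \<in> {0..T}"
  shows "(\<lambda>n. real (floor_idx n t) * mesh n) \<longlonglongrightarrow> t"
proof (rule tendsto_sandwich)
  show "(\<lambda>n. t - mesh n) \<longlonglongrightarrow> t"
    using tendsto_diff[OF tendsto_const[of t] mesh_tendsto] by simp
qed (use floor_idx[OF t] in auto)

lemma X_floor_tendsto:
  assumes t: "t \<in> {0..T}" and w: "\<omega> \<in> space M"
  shows "(\<lambda>n. X (real (floor_idx n t) * mesh n) \<omega>) \<longlonglongrightarrow> X t \<omega>"
  using continuous_on_tendsto_compose[OF X_continuous[OF w] floor_idx_tendsto[OF t] t]
    dyadic_in[OF floor_idx(1)[OF t]] by auto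

text \<open>From dyadic to arbitrary times by path continuity and boundedness of X. Integrating the
  oscillation over a whole step needs the bound at every time.\<close>

lemma X_diff_power4:
  assumes st: "0 \<le> s" "s \<le> t" "t \<le> T"
  shows "expectation (\<lambda>\<omega>. (X t \<omega> - X s \<omega>) ^ 4) \<le> L4 * (t - s)\<^sup>2"
proof (rule LIMSEQ_le)
  have inT: "s \<in> {0..T}" "t \<in> {0..T}" using st by auto
  let ?s = "\<lambda>n. real (floor_idx n s) * mesh n" and ?t = "\<lambda>n. real (floor_idx n t) * mesh n"
  have dy: "?s n \<in> {0..T}" "?t n \<in> {0..T}" for n
    using dyadic_in[OF floor_idx(1)[OF inT(1)]] dyadic_in[OF floor_idx(1)[OF inT(2)]] by auto
  show "(\<lambda>n. expectation (\<lambda>\<omega>. (X (?t n) \<omega> - X (?s n) \<omega>) ^ 4)) \<longlonglongrightarrow> expectation (\<lambda>\<omega>. (X t \<omega> - X s \<omega>) ^ 4)"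
  proof (rule integral_dominated_convergence[where w = "\<lambda>_. 1"])
    show "AE \<omega> in M. (\<lambda>n. (X (?t n) \<omega> - X (?s n) \<omega>) ^ 4) \<longlonglongrightarrow> (X t \<omega> - X s \<omega>) ^ 4"
      using X_floor_tendsto inT by (intro AE_I2 tendsto_power tendsto_diff) auto
    show "AE \<omega> in M. norm ((X (?t n) \<omega> - X (?s n) \<omega>) ^ 4) \<le> 1" for n
      using power_mono[OF X_diff_bound[OF _ dy(1) dy(2)], of _ n n 4] by (intro AE_I2) (simp add: power_abs)
  qed (use X_measurable inT dy in auto)
  show "(\<lambda>n. L4 * (?t n - ?s n)\<^sup>2) \<longlonglongrightarrow> L4 * (t - s)\<^sup>2"
    using floor_idx_tendsto inT by (intro tendsto_intros) auto
  have "floor_idx n s \<le> floor_idx n t" for n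
    unfolding floor_idx_def using st mesh_pos[of n] by (intro nat_mono floor_mono divide_right_mono) auto
  then show "\<exists>N. \<forall>n\<ge>N. expectation (\<lambda>\<omega>. (X (?t n) \<omega> - X (?s n) \<omega>) ^ 4) \<le> L4 * (?t n - ?s n)\<^sup>2"
    using X_diff_power4_dyadic floor_idx(1)[OF inT(2)] by blast
qed

text \<open>Lower moments follow from the fourth by comparing |x| with q = sqrt h: |x|^i <= x^4 /
  q^(4-i) + q^i. This yields the right order q^i without Hoelder's inequality, and the
  \<open>+ 1\<close> in the constant.\<close>

lemma X_diff_moment:
  assumes st: "0 \<le> s" "s \<le> t" "t \<le> T" "t - s \<le> h" and h: "0 < h"
  shows "expectation (\<lambda>\<omega>. \<bar>X t \<omega> - X s \<omega>\<bar>) \<le> (L4 + 1) * sqrt h"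
    and "expectation (\<lambda>\<omega>. \<bar>X t \<omega> - X s \<omega>\<bar> ^ 3) \<le> (L4 + 1) * sqrt h ^ 3"
proof -
  define q where "q = sqrt h"
  have q: "0 < q" "q ^ 4 = h\<^sup>2"
  proof -
    have "q ^ 4 = (q\<^sup>2)\<^sup>2" by (simp flip: power_mult)
    then show "q ^ 4 = h\<^sup>2" using h by (simp add: q_def)
  qed (use h in \<open>simp add: q_def\<close>)
  have inT: "s \<in> {0..T}" "t \<in> {0..T}" using st by auto
  note i4 = X_diff_power4_integrable[OF inT]
  have "expectation (\<lambda>\<omega>. (X t \<omega> - X s \<omega>) ^ 4) \<le> L4 * (t - s)\<^sup>2" by (rule X_diff_power4[OF st(1-3)])
  also have "\<dots> \<le> L4 * h\<^sup>2" using st L4_nonneg by (intro mult_left_mono power_mono) auto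
  finally have e4: "expectation (\<lambda>\<omega>. (X t \<omega> - X s \<omega>) ^ 4) \<le> L4 * q ^ 4" using q by simp
  have pw: "\<bar>x\<bar> ^ i \<le> x ^ 4 / q ^ (4 - i) + q ^ i" if "i \<le> 4" for x :: real and i
  proof (cases "\<bar>x\<bar> \<le> q")
    case True
    then have "\<bar>x\<bar> ^ i \<le> q ^ i" by (intro power_mono) auto
    then show ?thesis using q by (simp add: add_increasing)
  next
    case False
    have "\<bar>x\<bar> ^ i * q ^ (4 - i) \<le> \<bar>x\<bar> ^ i * \<bar>x\<bar> ^ (4 - i)"
      using False q by (intro mult_left_mono power_mono) auto
    also have "\<dots> = x ^ 4" using that by (simp flip: power_add)
    finally have "\<bar>x\<bar> ^ i \<le> x ^ 4 / q ^ (4 - i)" using q by (simp add: pos_le_divide_eq)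
    then show ?thesis using q by (simp add: add_increasing2)
  qed
  have gen: "expectation (\<lambda>\<omega>. \<bar>X t \<omega> - X s \<omega>\<bar> ^ i) \<le> (L4 + 1) * q ^ i" if i: "i \<le> 4" for i
  proof -
    have "expectation (\<lambda>\<omega>. \<bar>X t \<omega> - X s \<omega>\<bar> ^ i) \<le> expectation (\<lambda>\<omega>. (X t \<omega> - X s \<omega>) ^ 4 / q ^ (4 - i) + q ^ i)"
    proof (rule integral_mono)
      show "integrable M (\<lambda>\<omega>. \<bar>X t \<omega> - X s \<omega>\<bar> ^ i)"
      proof (rule integrable_const_bound[where B = 1])
        show "AE \<omega> in M. norm (\<bar>X t \<omega> - X s \<omega>\<bar> ^ i) \<le> 1"
          using X_diff_bound[OF _ inT] by (intro AE_I2) (auto intro: power_le_one)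
      qed (use X_measurable inT in auto)
    qed (use i4 pw[OF i] in auto)
    also have "\<dots> = expectation (\<lambda>\<omega>. (X t \<omega> - X s \<omega>) ^ 4) / q ^ (4 - i) + q ^ i"
      using i4 by (simp add: prob_space)
    also have "\<dots> \<le> L4 * q ^ 4 / q ^ (4 - i) + q ^ i"
      using e4 q by (intro add_mono divide_right_mono) auto
    also have "L4 * q ^ 4 / q ^ (4 - i) = L4 * q ^ i"
      using q(1) i by (simp add: power_diff)
    finally show ?thesis by (simp add: algebra_simps)
  qed
  show "expectation (\<lambda>\<omega>. \<bar>X t \<omega> - X s \<omega>\<bar>) \<le> (L4 + 1) * sqrt h"
    and "expectation (\<lambda>\<omega>. \<bar>X t \<omega> - X s \<omega>\<bar> ^ 3) \<le> (L4 + 1) * sqrt h ^ 3"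
    using gen[of 1] gen[of 3] by (simp_all add: q_def)
qed

text \<open>Fubini reduces the claim to the first moment at each time r. \<open>clip\<close> enters
  because joint measurability is known for the clipped process, which agrees with X on
  [s,t].\<close>

lemma X_osc_integral:
  assumes st: "0 \<le> s" "s < t" "t \<le> T"
  shows "integrable M (\<lambda>\<omega>. LBINT r:{s..t}. \<bar>X r \<omega> - X s \<omega>\<bar>)" (is ?int)
    and "expectation (\<lambda>\<omega>. LBINT r:{s..t}. \<bar>X r \<omega> - X s \<omega>\<bar>) \<le> (t - s) * ((L4 + 1) * sqrt (t - s))" (is ?le)
proof -
  interpret P: pair_sigma_finite M lborel ..
  have inT: "s \<in> {0..T}" "t \<in> {0..T}" using st by auto
  note [measurable] = X_measurable[OF inT(1)]
  let ?f = "\<lambda>(\<omega>, r). indicator {s..t} r * \<bar>X (clip r) \<omega> - X s \<omega>\<bar>"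
  have fm: "?f \<in> borel_measurable (M \<Otimes>\<^sub>M lborel)"
  proof -
    have "(\<lambda>z. indicator {s..t} (snd z) * \<bar>(case z of (\<omega>, s) \<Rightarrow> X (clip s) \<omega>) - X s (fst z)\<bar>) \<in> borel_measurable (M \<Otimes>\<^sub>M lborel)"
      by measurable
    then show ?thesis by (simp add: split_beta')
  qed
  have f_int: "integrable (M \<Otimes>\<^sub>M lborel) ?f"
  proof (rule integrableI_bounded_set[where A = "space M \<times> {s..t}" and B = 1])
    show "emeasure (M \<Otimes>\<^sub>M lborel) (space M \<times> {s..t}) < \<infinity>"
      by (subst lborel.emeasure_pair_measure_Times) (auto simp: emeasure_space_1 emeasure_lborel_Icc_eq)
    show "AE z in M \<Otimes>\<^sub>M lborel. z \<in> space M \<times> {s..t} \<longrightarrow> norm (?f z) \<le> 1"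
      using X_diff_bound[OF _ inT(1) clip(1)] by (intro AE_I2) auto
    show "AE z in M \<Otimes>\<^sub>M lborel. z \<notin> space M \<times> {s..t} \<longrightarrow> ?f z = 0"
      by (intro AE_I2) (auto simp: space_pair_measure indicator_def)
  qed (use fm in auto)
  have eq: "(LBINT r:{s..t}. \<bar>X r \<omega> - X s \<omega>\<bar>) = (\<integral>r. ?f (\<omega>, r) \<partial>lborel)" for \<omega>
    unfolding set_lebesgue_integral_def using st
    by (intro Bochner_Integration.integral_cong) (auto simp: indicator_def clip)
  show ?int unfolding eq using P.integrable_fst'[OF f_int] .
  have "expectation (\<lambda>\<omega>. LBINT r:{s..t}. \<bar>X r \<omega> - X s \<omega>\<bar>) = (\<integral>r. (\<integral>\<omega>. ?f (\<omega>, r) \<partial>M) \<partial>lborel)"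
    unfolding eq using P.Fubini_integral[of "\<lambda>\<omega> r. ?f (\<omega>, r)"] f_int by (simp add: split_beta')
  also have "\<dots> \<le> (\<integral>r. indicator {s..t} r * ((L4 + 1) * sqrt (t - s)) \<partial>lborel)"
  proof (rule integral_mono)
    show "integrable lborel (\<lambda>r. \<integral>\<omega>. ?f (\<omega>, r) \<partial>M)"
      using P.integrable_snd[of "\<lambda>\<omega> r. ?f (\<omega>, r)"] f_int by (simp add: split_beta')
    fix r :: real
    show "(\<integral>\<omega>. ?f (\<omega>, r) \<partial>M) \<le> indicator {s..t} r * ((L4 + 1) * sqrt (t - s))"
    proof (cases "r \<in> {s..t}")
      case True
      then have "expectation (\<lambda>\<omega>. \<bar>X r \<omega> - X s \<omega>\<bar>) \<le> (L4 + 1) * sqrt (t - s)"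
        using st by (intro X_diff_moment(1)) auto
      then show ?thesis using True clip(2)[of r] st by simp
    qed simp
  qed (auto simp: emeasure_lborel_Icc_eq)
  also have "\<dots> = (t - s) * ((L4 + 1) * sqrt (t - s))" using st by simp
  finally show ?le .
qed

end

section \<open>The logarithmic supermartingale\<close>

text \<open>The first three terms of ln (1 + u) leave a remainder with derivative x^2 / (1 + x). For
  u >= 0 it has a good sign; for u < 0 one has 1 / (1 + x) <= 1 / \<eta> on [u,0], and integrating
  x^2 / \<eta> produces the cubic term.\<close>

lemma neg_ln_one_plus_le:
  fixes u \<eta> :: real
  assumes \<eta>: "0 < \<eta>" and u: "\<eta> \<le> 1 + u"
  shows "- ln (1 + u) \<le> - u + u\<^sup>2 / 2 + \<bar>u\<bar> ^ 3 / (3 * \<eta>)"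
proof (cases "0 \<le> u")
  case True
  let ?g = "\<lambda>u :: real. ln (1 + u) - u + u\<^sup>2 / 2"
  have "?g 0 \<le> ?g u"
  proof (rule DERIV_nonneg_imp_nondecreasing[OF True])
    fix x :: real assume x: "0 \<le> x" "x \<le> u"
    have "(?g has_real_derivative 1 / (1 + x) - 1 + x) (at x)"
      using x by (auto intro!: derivative_eq_intros)
    moreover have "1 / (1 + x) - 1 + x = x\<^sup>2 / (1 + x)" using x by (simp add: field_simps power2_eq_square)
    ultimately show "\<exists>y. (?g has_real_derivative y) (at x) \<and> 0 \<le> y" using x by (intro exI[of _ "x\<^sup>2 / (1 + x)"]) simp
  qed
  then have "- ln (1 + u) \<le> - u + u\<^sup>2 / 2" by simp
  moreover have "0 \<le> \<bar>u\<bar> ^ 3 / (3 * \<eta>)" using \<eta> by simp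
  ultimately show ?thesis by linarith
next
  case False
  let ?g = "\<lambda>u :: real. ln (1 + u) - u + u\<^sup>2 / 2 - u ^ 3 / (3 * \<eta>)"
  have "?g 0 \<le> ?g u"
  proof (rule DERIV_nonpos_imp_nonincreasing[of u 0])
    fix x :: real assume x: "u \<le> x" "x \<le> 0"
    have x1: "\<eta> \<le> 1 + x" "0 < 1 + x" using x u \<eta> by auto
    have "(?g has_real_derivative 1 / (1 + x) - 1 + x - x\<^sup>2 / \<eta>) (at x)"
      using x1 \<eta> by (auto intro!: derivative_eq_intros simp: power2_eq_square)
    moreover have "1 / (1 + x) - 1 + x = x\<^sup>2 / (1 + x)" using x1 by (simp add: field_simps power2_eq_square)
    moreover have "x\<^sup>2 / (1 + x) \<le> x\<^sup>2 / \<eta>" using x1 \<eta> by (intro divide_left_mono) auto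
    ultimately show "\<exists>y. (?g has_real_derivative y) (at x) \<and> y \<le> 0" by (intro exI conjI) auto
  qed (use False in auto)
  moreover have "\<bar>u\<bar> ^ 3 = - (u ^ 3)" using False by simp
  ultimately show ?thesis by simp
qed

context affine_drift_sde
begin

text \<open>The integrand is bounded below by - 1/2, as 1/2 - z + z^2/2 = (1 - z)^2/2, so Fatou's lemma applies to it
  as a whole although its linear part has no sign.\<close>
lemma mart_step_estimate:
  assumes k: "k < 2 ^ m" and A: "A \<in> sets (F (real k * mesh m))" and \<epsilon>: "0 < \<epsilon>"
  defines "s \<equiv> real k * mesh m" and "t \<equiv> real (Suc k) * mesh m"
  defines "f \<equiv> \<lambda>\<omega>. indicator A \<omega> * (- (mart t \<omega> - mart s \<omega>) / (X s \<omega> + \<epsilon>)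
      + (mart t \<omega> - mart s \<omega>)\<^sup>2 / (2 * (X s \<omega> + \<epsilon>)\<^sup>2))"
  shows "integrable M f"
    and "expectation f \<le> a * mesh m * expectation (\<lambda>\<omega>. indicator A \<omega> * (X s \<omega> / (X s \<omega> + \<epsilon>)\<^sup>2))
      + a * (L4 + 1) / \<epsilon>\<^sup>2 * (mesh m * sqrt (mesh m))"
proof -
  let ?h = "mesh m"
  have j: "Suc k \<le> 2 ^ m" "k \<le> Suc k" using k by auto
  have inT: "s \<in> {0..T}" "t \<in> {0..T}"
    using dyadic_in[of k m] dyadic_in[OF j(1)] k by (auto simp: s_def t_def simp del: of_nat_Suc)
  have AM[measurable]: "A \<in> sets M" and AF[measurable]: "A \<in> sets (F s)"
    using A subalgebra_filtration[of s] by (auto simp: subalgebra_def s_def)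
  note [measurable] = X_measurable[OF inT(1)] X_adapted[OF inT(1)] mart_measurable[OF inT(1)] mart_measurable[OF inT(2)]
  have xe: "\<epsilon> \<le> X s \<omega> + \<epsilon>" if "\<omega> \<in> space M" for \<omega> using X_range[OF that inT(1)] by auto
  \<comment> \<open>\<open>Z1\<close> and \<open>Z2\<close> are the linear and quadratic Taylor
    coefficients. Both are known at time s and bounded thanks to \<epsilon>, hence legitimate
    weights for the martingale property and the isometry.\<close>
  define Z1 where "Z1 = (\<lambda>\<omega>. - indicator A \<omega> / (X s \<omega> + \<epsilon>))"
  define Z2 where "Z2 = (\<lambda>\<omega>. indicator A \<omega> / (2 * (X s \<omega> + \<epsilon>)\<^sup>2))"
  have Zm: "Z1 \<in> borel_measurable (F s)" "Z2 \<in> borel_measurable (F s)"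
    unfolding Z1_def Z2_def by measurable
  have [measurable]: "Z1 \<in> borel_measurable M" "Z2 \<in> borel_measurable M"
    using Zm filtration_measurable by auto
  have Z1b: "\<bar>Z1 \<omega>\<bar> \<le> 1 / \<epsilon>" if "\<omega> \<in> space M" for \<omega>
    using xe[OF that] \<epsilon> by (auto simp: Z1_def indicator_def divide_simps)
  have Z2b: "0 \<le> Z2 \<omega>" "\<bar>Z2 \<omega>\<bar> \<le> 1 / (2 * \<epsilon>\<^sup>2)" if "\<omega> \<in> space M" for \<omega>
  proof -
    have "\<epsilon>\<^sup>2 \<le> (X s \<omega> + \<epsilon>)\<^sup>2" using xe[OF that] \<epsilon> by (intro power_mono) auto
    moreover have "0 < \<epsilon>\<^sup>2" using \<epsilon> by simp
    ultimately have "1 / (2 * (X s \<omega> + \<epsilon>)\<^sup>2) \<le> 1 / (2 * \<epsilon>\<^sup>2)" by (intro frac_le) auto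
    then show "0 \<le> Z2 \<omega>" "\<bar>Z2 \<omega>\<bar> \<le> 1 / (2 * \<epsilon>\<^sup>2)"
      by (auto simp: Z2_def indicator_def)
  qed
  have ge: "0 \<le> 1 / 2 + (Z1 \<omega> * d + Z2 \<omega> * d\<^sup>2)" for \<omega> d
  proof -
    have sq: "1 / 2 + (- d / y + d\<^sup>2 / (2 * y\<^sup>2)) = (1 - d / y)\<^sup>2 / 2" for y :: real
      by (cases "y = 0") (auto simp: field_simps power2_eq_square)
    have "0 \<le> 1 / 2 + (- d / y + d\<^sup>2 / (2 * y\<^sup>2))" for y :: real unfolding sq by simp
    from this[of "X s \<omega> + \<epsilon>"] show ?thesis by (auto simp: Z1_def Z2_def indicator_def)
  qed
  have f_eq: "f \<omega> = Z1 \<omega> * (mart t \<omega> - mart s \<omega>) + Z2 \<omega> * (mart t \<omega> - mart s \<omega>)\<^sup>2" for \<omega>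
    unfolding f_def Z1_def Z2_def by (simp add: indicator_def diff_divide_distrib)
  obtain r :: "nat \<Rightarrow> nat" where r: "AE \<omega> in M. (\<lambda>n. level_sum m k (Suc k) (r n) \<omega>) \<longlonglongrightarrow> mart t \<omega> - mart s \<omega>"
    using level_sum_AE_subseq[OF j] unfolding s_def t_def by blast
  define Q where "Q = a * mesh m * expectation (\<lambda>\<omega>. indicator A \<omega> * (X s \<omega> / (X s \<omega> + \<epsilon>)\<^sup>2))
      + a * (L4 + 1) / \<epsilon>\<^sup>2 * (mesh m * sqrt (mesh m))"
  have level: "integrable M (\<lambda>\<omega>. Z1 \<omega> * level_sum m k (Suc k) n \<omega> + Z2 \<omega> * (level_sum m k (Suc k) n \<omega>)\<^sup>2)"
    "expectation (\<lambda>\<omega>. Z1 \<omega> * level_sum m k (Suc k) n \<omega> + Z2 \<omega> * (level_sum m k (Suc k) n \<omega>)\<^sup>2) \<le> Q" for n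
  proof -
    note tr = dyadic_transform[OF j, of n]
    have i1: "integrable M (\<lambda>\<omega>. Z1 \<omega> * level_sum m k (Suc k) n \<omega>)"
      using martingale_transform.S_integrable[OF tr order_refl, of 1 Z1 "1 / \<epsilon>"] Z1b by (simp add: level_sum_def)
    have i2: "integrable M (\<lambda>\<omega>. Z2 \<omega> * (level_sum m k (Suc k) n \<omega>)\<^sup>2)"
      using martingale_transform.S_integrable[OF tr order_refl, of 2 Z2 "1 / (2 * \<epsilon>\<^sup>2)"] Z2b by (simp add: level_sum_def)
    show "integrable M (\<lambda>\<omega>. Z1 \<omega> * level_sum m k (Suc k) n \<omega> + Z2 \<omega> * (level_sum m k (Suc k) n \<omega>)\<^sup>2)"
      using i1 i2 by simp
    have e1: "expectation (\<lambda>\<omega>. Z1 \<omega> * level_sum m k (Suc k) n \<omega>) = 0"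
      unfolding level_sum_def
      by (rule martingale_transform.expectation_S[OF tr _ Z1b order_refl]) (use Zm in \<open>auto simp: s_def\<close>)
    have e2: "expectation (\<lambda>\<omega>. Z2 \<omega> * (level_sum m k (Suc k) n \<omega>)\<^sup>2)
      = mesh (m + n) * (\<Sum>i<(Suc k - k) * 2 ^ n. expectation (\<lambda>\<omega>. Z2 \<omega> * (H (real k * mesh m + real i * mesh (m + n)) \<omega>)\<^sup>2))"
      unfolding level_sum_def
      by (rule martingale_transform.expectation_S_square[OF tr _ Z2b(2) order_refl]) (use Zm in \<open>auto simp: s_def\<close>)
    let ?E = "expectation (\<lambda>\<omega>. indicator A \<omega> * (X s \<omega> / (X s \<omega> + \<epsilon>)\<^sup>2))"
    let ?c = "a * ?E + a / \<epsilon>\<^sup>2 * ((L4 + 1) * sqrt ?h)"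
    \<comment> \<open>The volatility at the intermediate time u is at most 2 a (X s + |X u - X s|).
      Its factor 2 cancels the 1/2 in \<open>Z2\<close>; freezing X at s costs only E |X u - X s|,
      of order sqrt h uniformly in i and n.\<close>
    have summand_le: "expectation (\<lambda>\<omega>. Z2 \<omega> * (H (real k * mesh m + real i * mesh (m + n)) \<omega>)\<^sup>2) \<le> ?c"
      if i: "i < 2 ^ n" for i
    proof -
      define u where "u = real k * mesh m + real i * mesh (m + n)"
      have "real i \<le> 2 ^ n" using i by (metis less_imp_le of_nat_le_iff of_nat_numeral of_nat_power)
      then have "real i * mesh (m + n) \<le> 2 ^ n * mesh (m + n)" using mesh_pos[of "m + n"] by (intro mult_right_mono) auto
      also have "\<dots> = mesh m" using mesh_add[of m n] by (simp add: mult.commute)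
      finally have "real i * mesh (m + n) \<le> mesh m" .
      moreover have "0 \<le> real i * mesh (m + n)" using mesh_pos[of "m + n"] by simp
      moreover have "t = s + mesh m" by (simp add: s_def t_def algebra_simps)
      ultimately have u: "s \<le> u" "u - s \<le> ?h" "u \<le> t" unfolding u_def s_def[symmetric] by auto
      have uT: "u \<in> {0..T}" using u inT by auto
      note [measurable] = X_measurable[OF uT] filtration_measurable[OF H_adapted[OF uT]]
      have iA: "integrable M (\<lambda>\<omega>. indicator A \<omega> * (X s \<omega> / (X s \<omega> + \<epsilon>)\<^sup>2))"
      proof (rule integrable_const_bound[where B = "1 / \<epsilon>\<^sup>2"])
        show "AE \<omega> in M. norm (indicator A \<omega> * (X s \<omega> / (X s \<omega> + \<epsilon>)\<^sup>2)) \<le> 1 / \<epsilon>\<^sup>2"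
        proof (rule AE_I2)
          fix \<omega> assume w: "\<omega> \<in> space M"
          have "X s \<omega> / (X s \<omega> + \<epsilon>)\<^sup>2 \<le> 1 / \<epsilon>\<^sup>2"
            using X_range[OF w inT(1)] xe[OF w] \<epsilon> by (intro frac_le power_mono) auto
          then show "norm (indicator A \<omega> * (X s \<omega> / (X s \<omega> + \<epsilon>)\<^sup>2)) \<le> 1 / \<epsilon>\<^sup>2"
            using X_range[OF w inT(1)] by (auto simp: indicator_def)
        qed
      qed measurable
      have iX: "integrable M (\<lambda>\<omega>. \<bar>X u \<omega> - X s \<omega>\<bar>)"
        by (rule integrable_const_bound[where B = 1]) (use X_diff_bound[OF _ inT(1) uT] in auto)
      have "expectation (\<lambda>\<omega>. Z2 \<omega> * (H u \<omega>)\<^sup>2)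
          \<le> expectation (\<lambda>\<omega>. a * (indicator A \<omega> * (X s \<omega> / (X s \<omega> + \<epsilon>)\<^sup>2)) + a / \<epsilon>\<^sup>2 * \<bar>X u \<omega> - X s \<omega>\<bar>)"
      proof (rule integral_mono)
        show "integrable M (\<lambda>\<omega>. Z2 \<omega> * (H u \<omega>)\<^sup>2)"
        proof (rule integrable_const_bound[where B = "1 / (2 * \<epsilon>\<^sup>2) * (sqrt (2 * a))\<^sup>2"])
          show "AE \<omega> in M. norm (Z2 \<omega> * (H u \<omega>)\<^sup>2) \<le> 1 / (2 * \<epsilon>\<^sup>2) * (sqrt (2 * a))\<^sup>2"
          proof (rule AE_I2)
            fix \<omega> assume w: "\<omega> \<in> space M"
            show "norm (Z2 \<omega> * (H u \<omega>)\<^sup>2) \<le> 1 / (2 * \<epsilon>\<^sup>2) * (sqrt (2 * a))\<^sup>2"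
              unfolding real_norm_def abs_mult power_abs
              using Z2b[OF w] H_bound[OF w uT] by (intro mult_mono power_mono) auto
          qed
        qed measurable
        show "integrable M (\<lambda>\<omega>. a * (indicator A \<omega> * (X s \<omega> / (X s \<omega> + \<epsilon>)\<^sup>2)) + a / \<epsilon>\<^sup>2 * \<bar>X u \<omega> - X s \<omega>\<bar>)"
          using iA iX by (intro Bochner_Integration.integrable_add integrable_mult_right) auto
        fix \<omega> assume w: "\<omega> \<in> space M"
        have "Z2 \<omega> * (H u \<omega>)\<^sup>2 \<le> Z2 \<omega> * (2 * a * (X s \<omega> + \<bar>X u \<omega> - X s \<omega>\<bar>))"
        proof (intro mult_left_mono Z2b(1)[OF w])
          have "(H u \<omega>)\<^sup>2 \<le> 2 * a * X u \<omega>" by (rule H_square[OF w uT])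
          also have "\<dots> \<le> 2 * a * (X s \<omega> + \<bar>X u \<omega> - X s \<omega>\<bar>)" using a_pos by (intro mult_left_mono) auto
          finally show "(H u \<omega>)\<^sup>2 \<le> 2 * a * (X s \<omega> + \<bar>X u \<omega> - X s \<omega>\<bar>)" .
        qed
        also have "\<dots> = a * (indicator A \<omega> * (X s \<omega> / (X s \<omega> + \<epsilon>)\<^sup>2)) + Z2 \<omega> * (2 * a * \<bar>X u \<omega> - X s \<omega>\<bar>)"
          by (simp add: Z2_def algebra_simps)
        also have "Z2 \<omega> * (2 * a * \<bar>X u \<omega> - X s \<omega>\<bar>) \<le> 1 / (2 * \<epsilon>\<^sup>2) * (2 * a * \<bar>X u \<omega> - X s \<omega>\<bar>)"
          using Z2b[OF w] a_pos by (intro mult_right_mono) auto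
        finally show "Z2 \<omega> * (H u \<omega>)\<^sup>2 \<le> a * (indicator A \<omega> * (X s \<omega> / (X s \<omega> + \<epsilon>)\<^sup>2)) + a / \<epsilon>\<^sup>2 * \<bar>X u \<omega> - X s \<omega>\<bar>"
          by simp
      qed
      also have "\<dots> = a * ?E + a / \<epsilon>\<^sup>2 * expectation (\<lambda>\<omega>. \<bar>X u \<omega> - X s \<omega>\<bar>)"
        by (simp only: Bochner_Integration.integral_add integrable_mult_right integral_mult_right_zero iA iX)
      also have "\<dots> \<le> a * ?E + a / \<epsilon>\<^sup>2 * ((L4 + 1) * sqrt ?h)"
        using X_diff_moment(1)[of s u ?h] u inT uT mesh_pos a_pos \<epsilon>
        by (intro add_left_mono mult_left_mono) auto
      finally show ?thesis unfolding u_def .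
    qed
    have "(\<Sum>i<(Suc k - k) * 2 ^ n. expectation (\<lambda>\<omega>. Z2 \<omega> * (H (real k * mesh m + real i * mesh (m + n)) \<omega>)\<^sup>2)) \<le> (\<Sum>i<(2::nat) ^ n. ?c)"
      by (simp only: diff_Suc_1 Suc_diff_le[OF order_refl] diff_self_eq_0 One_nat_def[symmetric] mult_1)
         (intro sum_mono summand_le, simp)
    also have "\<dots> = 2 ^ n * ?c" by simp
    finally have "expectation (\<lambda>\<omega>. Z2 \<omega> * (level_sum m k (Suc k) n \<omega>)\<^sup>2) \<le> mesh (m + n) * (2 ^ n * ?c)"
      unfolding e2 using mesh_pos[of "m + n"] by (intro mult_left_mono) auto
    also have "\<dots> = mesh m * ?c" by (simp add: mesh_add[symmetric, of m n])
    also have "\<dots> = Q" by (simp add: Q_def algebra_simps add_divide_distrib)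
    finally show "expectation (\<lambda>\<omega>. Z1 \<omega> * level_sum m k (Suc k) n \<omega> + Z2 \<omega> * (level_sum m k (Suc k) n \<omega>)\<^sup>2) \<le> Q"
      using i1 i2 e1 by simp
  qed
  have Fat: "integrable M (\<lambda>\<omega>. 1 / 2 + f \<omega>)" "expectation (\<lambda>\<omega>. 1 / 2 + f \<omega>) \<le> 1 / 2 + Q"
  proof -
    let ?g = "\<lambda>n \<omega>. 1 / 2 + (Z1 \<omega> * level_sum m k (Suc k) (r n) \<omega> + Z2 \<omega> * (level_sum m k (Suc k) (r n) \<omega>)\<^sup>2)"
    have fm: "(\<lambda>\<omega>. 1 / 2 + f \<omega>) \<in> borel_measurable M" unfolding f_eq by measurable
    have gi: "integrable M (?g n)" for n using level(1) by simp
    have ge_g: "0 \<le> ?g n \<omega>" for n \<omega> using ge .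
    have ge_f: "0 \<le> 1 / 2 + f \<omega>" for \<omega> unfolding f_eq using ge .
    have lim: "AE \<omega> in M. (\<lambda>n. ?g n \<omega>) \<longlonglongrightarrow> 1 / 2 + f \<omega>"
      using r unfolding f_eq by eventually_elim (intro tendsto_intros)
    have bd: "expectation (?g n) \<le> 1 / 2 + Q" for n
      using level by (simp add: prob_space)
    show "integrable M (\<lambda>\<omega>. 1 / 2 + f \<omega>)" "expectation (\<lambda>\<omega>. 1 / 2 + f \<omega>) \<le> 1 / 2 + Q"
      using integrable_Fatou[OF fm gi ge_g ge_f lim bd] by blast+
  qed
  have "integrable M (\<lambda>\<omega>. (1 / 2 + f \<omega>) - 1 / 2)"
    using Fat(1) by (intro Bochner_Integration.integrable_diff) auto
  then show fi: "integrable M f" by simp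
  show "expectation f \<le> a * mesh m * expectation (\<lambda>\<omega>. indicator A \<omega> * (X s \<omega> / (X s \<omega> + \<epsilon>)\<^sup>2))
      + a * (L4 + 1) / \<epsilon>\<^sup>2 * (mesh m * sqrt (mesh m))"
    using Fat(2) fi by (simp add: prob_space Q_def)
qed


text \<open>One summand per source of error, in order: freezing the volatility, freezing the drift,
  replacing the squared increment of X by that of \<open>mart\<close>, and the cubic Taylor
  remainder.\<close>

definition "err_const \<epsilon> = (L4 + 1) * (a / \<epsilon>\<^sup>2 + K / \<epsilon> + K / \<epsilon>\<^sup>2 + 1 / (3 * (\<epsilon> / (1 + \<epsilon>)) * \<epsilon> ^ 3))"

text \<open>The pathwise part of the discrete Ito formula. The negative term with \<open>a\<close>
  is kept in exactly the shape in which the quadratic variation reappears in expectation, so that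
  the two cancel.\<close>

lemma log_increment_bound:
  assumes st: "0 \<le> s" "s < t" "t \<le> T" and w: "\<omega> \<in> space M" and \<epsilon>: "0 < \<epsilon>"
  shows "ln (X s \<omega> + \<epsilon>) - ln (X t \<omega> + \<epsilon>) \<le>
    (- (mart t \<omega> - mart s \<omega>) / (X s \<omega> + \<epsilon>) + (mart t \<omega> - mart s \<omega>)\<^sup>2 / (2 * (X s \<omega> + \<epsilon>)\<^sup>2))
    - a * (t - s) * (X s \<omega> / (X s \<omega> + \<epsilon>)\<^sup>2) + K * (t - s)
    + (K / \<epsilon> * (LBINT r:{s..t}. \<bar>X r \<omega> - X s \<omega>\<bar>) + K * (t - s) / \<epsilon>\<^sup>2 * \<bar>X t \<omega> - X s \<omega>\<bar>
      + 1 / (3 * (\<epsilon> / (1 + \<epsilon>)) * \<epsilon> ^ 3) * \<bar>X t \<omega> - X s \<omega>\<bar> ^ 3)"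
proof -
  define x where "x = X s \<omega>"
  define d where "d = X t \<omega> - X s \<omega>"
  define h where "h = t - s"
  define D where "D = mart t \<omega> - mart s \<omega>"
  define B where "B = drift t \<omega> - drift s \<omega>"
  define J where "J = (LBINT r:{s..t}. \<bar>X r \<omega> - X s \<omega>\<bar>)"
  \<comment> \<open>A lower bound for the ratio (X t + \<epsilon>) / (X s + \<epsilon>), since X
    lies in [0,1].\<close>
  define \<eta> where "\<eta> = \<epsilon> / (1 + \<epsilon>)"
  have xr: "0 \<le> x" "x \<le> 1" "0 \<le> X t \<omega>" "X t \<omega> \<le> 1" and h: "0 < h"
    using X_range[OF w, of s] X_range[OF w, of t] st by (auto simp: x_def h_def)
  have dDB: "d = D + B" by (simp add: d_def D_def B_def mart_def)
  have \<eta>: "0 < \<eta>" using \<epsilon> by (simp add: \<eta>_def)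
  have xe: "0 < x + \<epsilon>" "\<epsilon> \<le> x + \<epsilon>" using xr \<epsilon> by auto
  have 1: "1 + d / (x + \<epsilon>) = (X t \<omega> + \<epsilon>) / (x + \<epsilon>)" using xe by (simp add: d_def x_def field_simps)
  have "\<eta> \<le> (X t \<omega> + \<epsilon>) / (x + \<epsilon>)" unfolding \<eta>_def using xr \<epsilon> by (intro frac_le) auto
  then have "- ln (1 + d / (x + \<epsilon>)) \<le> - (d / (x + \<epsilon>)) + (d / (x + \<epsilon>))\<^sup>2 / 2 + \<bar>d / (x + \<epsilon>)\<bar> ^ 3 / (3 * \<eta>)"
    by (intro neg_ln_one_plus_le \<eta>) (simp add: 1)
  moreover have "- ln (1 + d / (x + \<epsilon>)) = ln (X s \<omega> + \<epsilon>) - ln (X t \<omega> + \<epsilon>)"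
    unfolding 1 using xr xe \<epsilon> by (subst ln_div) (auto simp: x_def)
  moreover have "(d / (x + \<epsilon>))\<^sup>2 / 2 \<le> D\<^sup>2 / (2 * (x + \<epsilon>)\<^sup>2) + K * h / \<epsilon>\<^sup>2 * \<bar>d\<bar>"
  proof -
    have Bb: "\<bar>B\<bar> \<le> K * h" unfolding B_def h_def using drift_diff_bounds(1)[of s t \<omega>] st w by simp
    \<comment> \<open>Written with d B instead of D B: only moments of the full increment d are used
      for the errors, and the term in \<open>B\<close> alone has the good sign.\<close>
    have "d\<^sup>2 = D\<^sup>2 + 2 * (d * B) - B\<^sup>2" unfolding dDB by (simp add: power2_eq_square algebra_simps)
    moreover have "d * B \<le> \<bar>d\<bar> * (K * h)"
      using Bb by (metis abs_ge_self abs_ge_zero abs_mult mult_left_mono order_trans)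
    ultimately have "d\<^sup>2 \<le> D\<^sup>2 + 2 * (\<bar>d\<bar> * (K * h))" by (smt (verit) zero_le_power2)
    then have "d\<^sup>2 / (2 * (x + \<epsilon>)\<^sup>2) \<le> (D\<^sup>2 + 2 * (\<bar>d\<bar> * (K * h))) / (2 * (x + \<epsilon>)\<^sup>2)"
      by (intro divide_right_mono) auto
    also have "\<dots> = D\<^sup>2 / (2 * (x + \<epsilon>)\<^sup>2) + \<bar>d\<bar> * (K * h) / (x + \<epsilon>)\<^sup>2"
      using xe by (simp add: add_divide_distrib)
    also have "\<bar>d\<bar> * (K * h) / (x + \<epsilon>)\<^sup>2 \<le> \<bar>d\<bar> * (K * h) / \<epsilon>\<^sup>2"
      using xe \<epsilon> K_pos h by (intro frac_le power_mono) auto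
    finally show ?thesis by (simp add: power_divide mult_ac)
  qed
  moreover have "\<bar>d / (x + \<epsilon>)\<bar> ^ 3 / (3 * \<eta>) \<le> 1 / (3 * \<eta> * \<epsilon> ^ 3) * \<bar>d\<bar> ^ 3"
  proof -
    have "\<bar>d / (x + \<epsilon>)\<bar> ^ 3 = \<bar>d\<bar> ^ 3 / (x + \<epsilon>) ^ 3" using xe by (simp add: power_divide)
    also have "\<dots> \<le> \<bar>d\<bar> ^ 3 / \<epsilon> ^ 3" using xe \<epsilon> by (intro frac_le power_mono) auto
    finally have "\<bar>d / (x + \<epsilon>)\<bar> ^ 3 / (3 * \<eta>) \<le> \<bar>d\<bar> ^ 3 / \<epsilon> ^ 3 / (3 * \<eta>)"
      using \<eta> by (intro divide_right_mono) auto
    then show ?thesis by (simp add: field_simps)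
  qed
  moreover have "- (d / (x + \<epsilon>)) \<le> - D / (x + \<epsilon>) - a * h * (x / (x + \<epsilon>)\<^sup>2) + K * h + K / \<epsilon> * J"
  proof -
    have iX: "set_integrable lborel {s..t} (\<lambda>r. X r \<omega>)"
      by (rule borel_integrable_atLeastAtMost', rule continuous_on_subset[OF X_continuous[OF w]]) (use st in auto)
    have ic: "set_integrable lborel {s..t} (\<lambda>r. x)"
      by (auto simp: set_integrable_def emeasure_lborel_Icc_eq)
    have iJ: "set_integrable lborel {s..t} (\<lambda>r. \<bar>X r \<omega> - X s \<omega>\<bar>)"
      using set_integrable_abs[OF set_integral_diff(1)[OF iX ic]] by (simp add: x_def)
    have "(LBINT r:{s..t}. X r \<omega>) \<le> (LBINT r:{s..t}. x + \<bar>X r \<omega> - X s \<omega>\<bar>)"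
      by (intro set_integral_mono iX set_integral_add ic iJ) (auto simp: x_def)
    also have "\<dots> = x * h + J"
      using st by (subst set_integral_add(2)[OF ic iJ]) (auto simp: J_def h_def set_lebesgue_integral_def)
    finally have "a * h - K * (x * h + J) \<le> a * h - K * (LBINT r:{s..t}. X r \<omega>)"
      using K_pos by (intro diff_left_mono mult_left_mono) auto
    also have "\<dots> \<le> B" unfolding B_def h_def using drift_diff_bounds(2)[of s t \<omega>] st w by simp
    finally have "- B / (x + \<epsilon>) \<le> (- (a * h) + K * x * h + K * J) / (x + \<epsilon>)"
      using xe by (intro divide_right_mono) (auto simp: algebra_simps)
    also have "\<dots> = - (a * h * (1 / (x + \<epsilon>))) + K * h * (x / (x + \<epsilon>)) + K * J / (x + \<epsilon>)"
      by (simp add: add_divide_distrib diff_divide_distrib algebra_simps)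
    \<comment> \<open>Here a \<epsilon> / (x + \<epsilon>)^2 is given away, the surplus of the drift
      over the quadratic variation.\<close>
    also have "\<dots> \<le> - (a * h * (x / (x + \<epsilon>)\<^sup>2)) + K * h * 1 + K * J / \<epsilon>"
    proof (intro add_mono mult_left_mono le_imp_neg_le)
      have "x / (x + \<epsilon>)\<^sup>2 \<le> (x + \<epsilon>) / (x + \<epsilon>)\<^sup>2" using \<epsilon> by (intro divide_right_mono) auto
      then show "x / (x + \<epsilon>)\<^sup>2 \<le> 1 / (x + \<epsilon>)" using xe by (simp add: power2_eq_square)
      show "x / (x + \<epsilon>) \<le> 1" using xe \<epsilon> by simp
      have "0 \<le> J" unfolding J_def set_lebesgue_integral_def by (intro integral_nonneg_AE) auto
      then show "K * J / (x + \<epsilon>) \<le> K * J / \<epsilon>" using xe \<epsilon> K_pos by (intro frac_le) auto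
    qed (use a_pos K_pos h in auto)
    finally show ?thesis unfolding dDB by (simp add: add_divide_distrib diff_divide_distrib)
  qed
  ultimately show ?thesis
    unfolding x_def d_def h_def D_def J_def \<eta>_def by linarith
qed

text \<open>The supermartingale inequality over one grid step up to an error of order h^(3/2),
  localised to an event \<open>A\<close> of the past; \<open>A\<close> will be the event that the
  path has not yet gone below \<epsilon> on the grid.\<close>

lemma one_step:
  assumes k: "k < 2 ^ m" and A: "A \<in> sets (F (real k * mesh m))" and \<epsilon>: "0 < \<epsilon>"
  shows "expectation (\<lambda>\<omega>. indicator A \<omega> * (ln (X (real k * mesh m) \<omega> + \<epsilon>) - ln (X (real (Suc k) * mesh m) \<omega> + \<epsilon>)))
    \<le> K * mesh m + err_const \<epsilon> * (mesh m * sqrt (mesh m))"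
proof -
  define s where "s = real k * mesh m"
  define t where "t = real (Suc k) * mesh m"
  define h where "h = mesh m"
  have ts: "t - s = h" by (simp add: s_def t_def h_def algebra_simps)
  have h: "0 < h" using mesh_pos by (simp add: h_def)
  have inT: "s \<in> {0..T}" "t \<in> {0..T}"
    using dyadic_in[of k m] dyadic_in[of "Suc k" m] k by (auto simp: s_def t_def simp del: of_nat_Suc)
  have st: "0 \<le> s" "s < t" "t \<le> T" using inT ts h by auto
  have [measurable]: "A \<in> sets M"
    using A subalgebra_filtration by (auto simp: subalgebra_def)
  note [measurable] = X_measurable[OF inT(1)] X_measurable[OF inT(2)]
  define f where "f = (\<lambda>\<omega>. indicator A \<omega> * (- (mart t \<omega> - mart s \<omega>) / (X s \<omega> + \<epsilon>)
      + (mart t \<omega> - mart s \<omega>)\<^sup>2 / (2 * (X s \<omega> + \<epsilon>)\<^sup>2)))"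
  define g where "g = (\<lambda>\<omega>. indicator A \<omega> * (X s \<omega> / (X s \<omega> + \<epsilon>)\<^sup>2))"
  define J where "J = (\<lambda>\<omega>. LBINT r:{s..t}. \<bar>X r \<omega> - X s \<omega>\<bar>)"
  define c where "c = 1 / (3 * (\<epsilon> / (1 + \<epsilon>)) * \<epsilon> ^ 3)"
  define R where "R = (\<lambda>\<omega>. K / \<epsilon> * J \<omega> + K * h / \<epsilon>\<^sup>2 * \<bar>X t \<omega> - X s \<omega>\<bar> + c * \<bar>X t \<omega> - X s \<omega>\<bar> ^ 3)"
  have c: "0 \<le> c" using \<epsilon> by (simp add: c_def)
  have fi: "integrable M f" and fE: "expectation f \<le> a * h * expectation g + a * (L4 + 1) / \<epsilon>\<^sup>2 * (h * sqrt h)"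
    using mart_step_estimate[OF k A \<epsilon>] unfolding f_def g_def s_def t_def h_def by auto
  have gi: "integrable M g"
  proof (rule integrable_const_bound[where B = "1 / \<epsilon>\<^sup>2"])
    show "AE \<omega> in M. norm (g \<omega>) \<le> 1 / \<epsilon>\<^sup>2"
    proof (rule AE_I2)
      fix \<omega> assume w: "\<omega> \<in> space M"
      have "X s \<omega> / (X s \<omega> + \<epsilon>)\<^sup>2 \<le> 1 / \<epsilon>\<^sup>2"
        using X_range[OF w inT(1)] \<epsilon> by (intro frac_le power_mono) auto
      then show "norm (g \<omega>) \<le> 1 / \<epsilon>\<^sup>2"
        using X_range[OF w inT(1)] by (auto simp: indicator_def g_def)
    qed
  qed (simp add: g_def)
  have di: "integrable M (\<lambda>\<omega>. \<bar>X t \<omega> - X s \<omega>\<bar>)" "integrable M (\<lambda>\<omega>. \<bar>X t \<omega> - X s \<omega>\<bar> ^ 3)"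
    by (rule integrable_const_bound[where B = 1]; use X_diff_bound[OF _ inT] in \<open>auto intro!: power_le_one\<close>)+
  have Ji: "integrable M J" and JE: "expectation J \<le> h * ((L4 + 1) * sqrt h)"
    using X_osc_integral[OF st] by (auto simp: J_def ts)
  have Ri: "integrable M R" unfolding R_def using di Ji by auto
  have "expectation R = K / \<epsilon> * expectation J + K * h / \<epsilon>\<^sup>2 * expectation (\<lambda>\<omega>. \<bar>X t \<omega> - X s \<omega>\<bar>)
      + c * expectation (\<lambda>\<omega>. \<bar>X t \<omega> - X s \<omega>\<bar> ^ 3)"
    unfolding R_def using di Ji by simp
  also have "\<dots> \<le> K / \<epsilon> * (h * ((L4 + 1) * sqrt h)) + K * h / \<epsilon>\<^sup>2 * ((L4 + 1) * sqrt h) + c * ((L4 + 1) * sqrt h ^ 3)"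
    using JE X_diff_moment[of s t h] st ts h K_pos \<epsilon> c by (intro add_mono mult_left_mono) auto
  also have "sqrt h ^ 3 = h * sqrt h" using h by (simp add: power3_eq_cube)
  finally have RE: "expectation R \<le> K / \<epsilon> * (h * ((L4 + 1) * sqrt h)) + K * h / \<epsilon>\<^sup>2 * ((L4 + 1) * sqrt h) + c * ((L4 + 1) * (h * sqrt h))" .
  have "expectation (\<lambda>\<omega>. indicator A \<omega> * (ln (X s \<omega> + \<epsilon>) - ln (X t \<omega> + \<epsilon>)))
      \<le> expectation (\<lambda>\<omega>. f \<omega> - a * h * g \<omega> + K * h + R \<omega>)"
  proof (rule integral_mono)
    show "integrable M (\<lambda>\<omega>. f \<omega> - a * h * g \<omega> + K * h + R \<omega>)" using fi gi Ri by auto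
    show "integrable M (\<lambda>\<omega>. indicator A \<omega> * (ln (X s \<omega> + \<epsilon>) - ln (X t \<omega> + \<epsilon>)))"
    proof (rule integrable_const_bound[where B = "ln (1 + \<epsilon>) - ln \<epsilon>"])
      show "AE \<omega> in M. norm (indicator A \<omega> * (ln (X s \<omega> + \<epsilon>) - ln (X t \<omega> + \<epsilon>))) \<le> ln (1 + \<epsilon>) - ln \<epsilon>"
      proof (rule AE_I2)
        fix \<omega> assume w: "\<omega> \<in> space M"
        have "ln \<epsilon> \<le> ln (X s \<omega> + \<epsilon>)" "ln (X s \<omega> + \<epsilon>) \<le> ln (1 + \<epsilon>)" "ln \<epsilon> \<le> ln (X t \<omega> + \<epsilon>)" "ln (X t \<omega> + \<epsilon>) \<le> ln (1 + \<epsilon>)"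
          using X_range[OF w inT(1)] X_range[OF w inT(2)] \<epsilon> by (auto simp: add_nonneg_pos)
        then show "norm (indicator A \<omega> * (ln (X s \<omega> + \<epsilon>) - ln (X t \<omega> + \<epsilon>))) \<le> ln (1 + \<epsilon>) - ln \<epsilon>"
          by (auto simp: indicator_def)
      qed
    qed measurable
    fix \<omega> assume w: "\<omega> \<in> space M"
    \<comment> \<open>Off \<open>A\<close> everything carrying the indicator is 0, and the
      inequality becomes 0 <= K h + R; hence these sign checks.\<close>
    have "0 \<le> J \<omega>" unfolding J_def set_lebesgue_integral_def by (intro integral_nonneg_AE) auto
    then have "0 \<le> R \<omega>" using K_pos \<epsilon> h c by (auto simp: R_def intro!: add_nonneg_nonneg)
    moreover have "0 \<le> K * h" using K_pos h by simp
    ultimately show "indicator A \<omega> * (ln (X s \<omega> + \<epsilon>) - ln (X t \<omega> + \<epsilon>)) \<le> f \<omega> - a * h * g \<omega> + K * h + R \<omega>"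
      using log_increment_bound[OF st w \<epsilon>] unfolding f_def g_def R_def J_def c_def ts
      by (auto simp: indicator_def)
  qed
  also have "\<dots> = expectation f - a * h * expectation g + K * h + expectation R"
    using fi gi Ri by (simp add: prob_space)
  \<comment> \<open>The key cancellation: \<open>a * h * expectation g\<close> bounds the quadratic
    variation part of f and is subtracted again as the contribution of the drift.\<close>
  also have "\<dots> \<le> a * (L4 + 1) / \<epsilon>\<^sup>2 * (h * sqrt h) + K * h
      + (K / \<epsilon> * (h * ((L4 + 1) * sqrt h)) + K * h / \<epsilon>\<^sup>2 * ((L4 + 1) * sqrt h) + c * ((L4 + 1) * (h * sqrt h)))"
    using fE RE by linarith
  also have "\<dots> = K * h + err_const \<epsilon> * (h * sqrt h)"
    unfolding err_const_def c_def[symmetric] by (simp add: algebra_simps add_divide_distrib)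
  finally show ?thesis unfolding s_def t_def h_def .
qed

section \<open>Maximal inequality on the grids and positivity of the solution\<close>

lemma x0_le: "x0 \<le> 1"
proof -
  obtain \<omega> where w: "\<omega> \<in> space M" using not_empty by blast
  show ?thesis using X_range[OF w, of 0] X_start[OF w] T_pos by simp
qed

definition "stays_above \<epsilon> m k = {\<omega> \<in> space M. \<forall>l\<le>k. \<epsilon> \<le> X (real l * mesh m) \<omega>}"

lemma stays_above_sets:
  assumes k: "k \<le> 2 ^ m"
  shows "stays_above \<epsilon> m k \<in> sets (F (real k * mesh m))"
proof -
  have sp: "space M = space (F (real k * mesh m))" using subalgebra_filtration by (simp add: subalgebra_def)
  have [measurable]: "X (real l * mesh m) \<in> borel_measurable (F (real k * mesh m))" if "l \<le> k" for l
  proof (rule filtration_measurable_mono[OF X_adapted])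
    show "real l * mesh m \<in> {0..T}" using that k by (intro dyadic_in) simp
    show "real l * mesh m \<le> real k * mesh m" using that mesh_pos[of m] by (intro mult_right_mono) auto
  qed
  have "stays_above \<epsilon> m k = (\<Inter>l\<in>{..k}. {\<omega> \<in> space (F (real k * mesh m)). \<epsilon> \<le> X (real l * mesh m) \<omega>})"
    by (auto simp: stays_above_def sp)
  also have "\<dots> \<in> sets (F (real k * mesh m))"
    by (intro sets.finite_INT) auto
  finally show ?thesis .
qed

text \<open>A maximal inequality without stopping times: the functional ?g of the proof equals V as long as the path has
  stayed above \<open>\<epsilon>\<close> on the grid and is frozen at \<open>- ln (2 * \<epsilon>)\<close> afterwards.\<close>
lemma below_prob_bound:
  assumes \<epsilon>: "0 < \<epsilon>" "\<epsilon> \<le> x0" "2 * \<epsilon> \<le> 1"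
  shows "- ln (2 * \<epsilon>) * (1 - prob (stays_above \<epsilon> m (2 ^ m)))
    \<le> ln 2 - ln x0 + K * T + err_const \<epsilon> * T * sqrt (mesh m)"
proof -
  define \<kappa> where "\<kappa> = - ln (2 * \<epsilon>)"
  have \<kappa>: "0 \<le> \<kappa>" using \<epsilon> by (simp add: \<kappa>_def)
  define step where "step = K * mesh m + err_const \<epsilon> * (mesh m * sqrt (mesh m))"
  define Y where "Y k \<omega> = - ln (X (real k * mesh m) \<omega> + \<epsilon>)" for k \<omega>
  let ?A = "stays_above \<epsilon> m"
  let ?g = "\<lambda>k \<omega>. indicator (?A k) \<omega> * Y k \<omega> + (1 - indicator (?A k) \<omega>) * \<kappa>"
  have AM[measurable]: "?A k \<in> sets M" if "k \<le> 2 ^ m" for k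
    using stays_above_sets[OF that] subalgebra_filtration by (auto simp: subalgebra_def)
  have Yb: "- ln (1 + \<epsilon>) \<le> Y k \<omega>" "Y k \<omega> \<le> - ln \<epsilon>" if "k \<le> 2 ^ m" "\<omega> \<in> space M" for k \<omega>
    using X_range[OF that(2) dyadic_in[OF that(1)]] \<epsilon> by (auto simp: Y_def add_nonneg_pos)
  have Ym[measurable]: "Y k \<in> borel_measurable M" if "k \<le> 2 ^ m" for k
    unfolding Y_def[abs_def] using X_measurable[OF dyadic_in[OF that]] by measurable
  have Yi: "integrable M (\<lambda>\<omega>. indicator B \<omega> * Y k \<omega>)" if "k \<le> 2 ^ m" "B \<in> sets M" for B k
  proof (rule integrable_const_bound[where B = "\<bar>ln (1 + \<epsilon>)\<bar> + \<bar>ln \<epsilon>\<bar>"])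
    show "AE \<omega> in M. norm (indicator B \<omega> * Y k \<omega>) \<le> \<bar>ln (1 + \<epsilon>)\<bar> + \<bar>ln \<epsilon>\<bar>"
    proof (rule AE_I2)
      fix \<omega> assume w: "\<omega> \<in> space M"
      show "norm (indicator B \<omega> * Y k \<omega>) \<le> \<bar>ln (1 + \<epsilon>)\<bar> + \<bar>ln \<epsilon>\<bar>"
        using Yb[OF that(1) w] by (auto simp: indicator_def)
    qed
  qed (use that Ym[OF that(1)] in auto)
  have gi: "integrable M (?g k)" if "k \<le> 2 ^ m" for k
    using Yi[OF that AM[OF that]] AM[OF that]
    by (intro Bochner_Integration.integrable_add integrable_mult_left Bochner_Integration.integrable_diff)
       (auto simp: emeasure_eq_measure)
  have main: "expectation (?g k) \<le> - ln (x0 + \<epsilon>) + real k * step" if "k \<le> 2 ^ m" for k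
    using that
  proof (induction k)
    case 0
    \<comment> \<open>As \<epsilon> <= x0, no path is frozen at time 0.\<close>
    have "expectation (?g 0) = expectation (\<lambda>_. - ln (x0 + \<epsilon>))"
      using X_start \<epsilon> by (intro Bochner_Integration.integral_cong) (auto simp: stays_above_def Y_def indicator_def)
    then show ?case by (simp add: prob_space)
  next
    case (Suc k)
    have k: "k < 2 ^ m" "k \<le> 2 ^ m" using Suc by auto
    have di: "integrable M (\<lambda>\<omega>. indicator (?A k) \<omega> * (Y (Suc k) \<omega> - Y k \<omega>))"
      using Bochner_Integration.integrable_diff[OF Yi[OF Suc.prems AM[OF k(2)]] Yi[OF k(2) AM[OF k(2)]]]
      by (simp add: right_diff_distrib)
    have "expectation (?g (Suc k)) \<le> expectation (\<lambda>\<omega>. ?g k \<omega> + indicator (?A k) \<omega> * (Y (Suc k) \<omega> - Y k \<omega>))"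
    proof (rule integral_mono[OF gi[OF Suc.prems] Bochner_Integration.integrable_add[OF gi[OF k(2)] di]])
      fix \<omega> assume w: "\<omega> \<in> space M"
      have sub: "\<omega> \<in> ?A (Suc k) \<Longrightarrow> \<omega> \<in> ?A k" by (auto simp: stays_above_def)
      \<comment> \<open>On the step of exit X + \<epsilon> < 2 \<epsilon>, so freezing at \<kappa>
        can only lower the value. This is the reason for the level
        \<open>- ln (2 * \<epsilon>)\<close>: an exit may overshoot \<epsilon>, but only
        downwards.\<close>
      have "\<kappa> \<le> Y (Suc k) \<omega>" if "\<omega> \<in> ?A k" "\<omega> \<notin> ?A (Suc k)"
      proof -
        have "X (real (Suc k) * mesh m) \<omega> < \<epsilon>"
          using that w by (auto simp: stays_above_def le_Suc_eq not_le simp del: of_nat_Suc)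
        then have "X (real (Suc k) * mesh m) \<omega> + \<epsilon> \<le> 2 * \<epsilon>" by simp
        then show ?thesis
          unfolding \<kappa>_def Y_def using X_range[OF w dyadic_in[OF Suc.prems]] \<epsilon>
          by (simp add: add_nonneg_pos del: of_nat_Suc)
      qed
      then show "?g (Suc k) \<omega> \<le> ?g k \<omega> + indicator (?A k) \<omega> * (Y (Suc k) \<omega> - Y k \<omega>)"
        using sub by (auto simp: indicator_def)
    qed
    also have "\<dots> = expectation (?g k) + expectation (\<lambda>\<omega>. indicator (?A k) \<omega> * (Y (Suc k) \<omega> - Y k \<omega>))"
      by (rule Bochner_Integration.integral_add[OF gi[OF k(2)] di])
    also have "expectation (\<lambda>\<omega>. indicator (?A k) \<omega> * (Y (Suc k) \<omega> - Y k \<omega>)) \<le> step"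
      using one_step[OF k(1) stays_above_sets[OF k(2)] \<epsilon>(1)] by (simp add: step_def Y_def del: of_nat_Suc)
    finally show ?case using Suc.IH[OF k(2)] by (simp add: algebra_simps)
  qed
  \<comment> \<open>V may be negative, but X <= 1 and \<epsilon> <= 1 give V >= - ln 2, so
    subtracting ln 2 yields a lower bound both on paths that survived and on frozen ones.\<close>
  have "- ln 2 + (1 - prob (?A (2 ^ m))) * \<kappa> = expectation (\<lambda>\<omega>. - ln 2 + (1 - indicator (?A (2 ^ m)) \<omega>) * \<kappa>)"
    using AM[OF order_refl] by (simp add: prob_space emeasure_eq_measure)
  also have "\<dots> \<le> expectation (?g (2 ^ m))"
  proof (rule integral_mono)
    show "integrable M (\<lambda>\<omega>. - ln 2 + (1 - indicator (?A (2 ^ m)) \<omega>) * \<kappa>)"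
      using AM[OF order_refl]
      by (intro Bochner_Integration.integrable_add integrable_mult_left Bochner_Integration.integrable_diff)
         (auto simp: emeasure_eq_measure)
    fix \<omega> assume w: "\<omega> \<in> space M"
    have "ln (1 + \<epsilon>) \<le> ln 2" "0 \<le> ln (2::real)" using \<epsilon> by auto
    then show "- ln 2 + (1 - indicator (?A (2 ^ m)) \<omega>) * \<kappa> \<le> ?g (2 ^ m) \<omega>"
      using Yb[OF order_refl w] by (auto simp: indicator_def)
  qed (rule gi[OF order_refl])
  also have "\<dots> \<le> - ln (x0 + \<epsilon>) + real (2 ^ m) * step" by (rule main[OF order_refl])
  also have "real (2 ^ m) * step = K * T + err_const \<epsilon> * T * sqrt (mesh m)"
  proof -
    have "2 ^ m * mesh m = T" by (simp add: mesh_def)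
    then show ?thesis unfolding step_def by (simp add: algebra_simps)
  qed
  also have "- ln (x0 + \<epsilon>) \<le> - ln x0" using x0_pos \<epsilon> by simp
  finally show ?thesis unfolding \<kappa>_def by (simp add: algebra_simps)
qed

text \<open>The grid is refined with \<epsilon> fixed. The events increase, since point l of one
  grid is point 2 l of the next, and the error term disappears with the mesh.\<close>

lemma below_ever_prob_bound:
  assumes \<epsilon>: "0 < \<epsilon>" "\<epsilon> \<le> x0" "2 * \<epsilon> \<le> 1"
  shows "- ln (2 * \<epsilon>) * prob (\<Union>m. space M - stays_above \<epsilon> m (2 ^ m)) \<le> ln 2 - ln x0 + K * T"
proof (rule LIMSEQ_le)
  have AM[measurable]: "stays_above \<epsilon> m (2 ^ m) \<in> sets M" for m
    using stays_above_sets[of "2 ^ m" m] subalgebra_filtration by (auto simp: subalgebra_def)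
  have "stays_above \<epsilon> (Suc m) (2 ^ Suc m) \<subseteq> stays_above \<epsilon> m (2 ^ m)" for m
  proof
    fix \<omega> assume w: "\<omega> \<in> stays_above \<epsilon> (Suc m) (2 ^ Suc m)"
    have "\<epsilon> \<le> X (real l * mesh m) \<omega>" if "l \<le> 2 ^ m" for l
    proof -
      have "\<epsilon> \<le> X (real (2 * l) * mesh (Suc m)) \<omega>"
        using w that unfolding stays_above_def by (metis (mono_tags, lifting) mem_Collect_eq mult_le_mono2 power_Suc)
      then show ?thesis by (simp add: mesh_def)
    qed
    then show "\<omega> \<in> stays_above \<epsilon> m (2 ^ m)" using w by (auto simp: stays_above_def)
  qed
  then have "incseq (\<lambda>m. space M - stays_above \<epsilon> m (2 ^ m))" by (intro incseq_SucI) blast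
  then have "(\<lambda>m. prob (space M - stays_above \<epsilon> m (2 ^ m))) \<longlonglongrightarrow> prob (\<Union>m. space M - stays_above \<epsilon> m (2 ^ m))"
    by (intro finite_Lim_measure_incseq) auto
  then show "(\<lambda>m. - ln (2 * \<epsilon>) * prob (space M - stays_above \<epsilon> m (2 ^ m))) \<longlonglongrightarrow> - ln (2 * \<epsilon>) * prob (\<Union>m. space M - stays_above \<epsilon> m (2 ^ m))"
    by (intro tendsto_mult tendsto_const)
  have "(\<lambda>m. ln 2 - ln x0 + K * T + err_const \<epsilon> * T * sqrt (mesh m)) \<longlonglongrightarrow> ln 2 - ln x0 + K * T + err_const \<epsilon> * T * sqrt 0"
    by (intro tendsto_intros mesh_tendsto)
  then show "(\<lambda>m. ln 2 - ln x0 + K * T + err_const \<epsilon> * T * sqrt (mesh m)) \<longlonglongrightarrow> ln 2 - ln x0 + K * T" by simp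
  show "\<exists>N. \<forall>m\<ge>N. - ln (2 * \<epsilon>) * prob (space M - stays_above \<epsilon> m (2 ^ m)) \<le> ln 2 - ln x0 + K * T + err_const \<epsilon> * T * sqrt (mesh m)"
    using below_prob_bound[OF \<epsilon>] AM by (auto simp: prob_compl)
qed

text \<open>A path that reaches 0 lies, by continuity, below every positive level at some dyadic
  time. The event \<open>N\<close> of this has probability at most R / (i + 1) for all i.\<close>

theorem AE_solution_pos: "AE \<omega> in M. \<forall>t\<in>{0..T}. 0 < X t \<omega>"
proof -
  \<comment> \<open>Chosen to satisfy - ln (2 e_i) = i + 1 - ln x0 >= i + 1, together with the
    conditions on \<epsilon> in the maximal inequality.\<close>
  define e where "e i = x0 * exp (- real (Suc i)) / 2" for i
  have e: "0 < e i" "e i \<le> x0" "2 * e i \<le> 1" "real (Suc i) \<le> - ln (2 * e i)" for i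
  proof -
    have ex: "exp (- real (Suc i)) \<le> 1" by simp
    show "0 < e i" using x0_pos by (simp add: e_def)
    have "x0 * exp (- real (Suc i)) \<le> x0 * 1" using ex x0_pos by (intro mult_left_mono) auto
    then show "e i \<le> x0" "2 * e i \<le> 1" unfolding e_def using x0_pos x0_le by linarith+
    have "ln (2 * e i) = ln x0 - real (Suc i)" using x0_pos by (simp add: e_def ln_mult)
    moreover have "ln x0 \<le> 0" using x0_pos x0_le by simp
    ultimately show "real (Suc i) \<le> - ln (2 * e i)" by simp
  qed
  define U where "U i = (\<Union>m. space M - stays_above (e i) m (2 ^ m))" for i
  define N where "N = (\<Inter>i. U i)"
  have AM[measurable]: "stays_above \<epsilon> m (2 ^ m) \<in> sets M" for m \<epsilon>
    using stays_above_sets[of "2 ^ m" m] subalgebra_filtration by (auto simp: subalgebra_def)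
  have [measurable]: "U i \<in> sets M" for i unfolding U_def by measurable
  have NM[measurable]: "N \<in> sets M" unfolding N_def by measurable
  define R where "R = ln 2 - ln x0 + K * T"
  have bd: "real (Suc i) * prob N \<le> R" for i
  proof -
    have "real (Suc i) * prob N \<le> real (Suc i) * prob (U i)"
      by (intro mult_left_mono finite_measure_mono) (auto simp: N_def)
    also have "\<dots> \<le> - ln (2 * e i) * prob (U i)" using e(4)[of i] by (intro mult_right_mono) auto
    also have "\<dots> \<le> R" unfolding U_def R_def by (rule below_ever_prob_bound[OF e(1-3)])
    finally show ?thesis .
  qed
  have "prob N = 0"
  proof (rule ccontr)
    assume "prob N \<noteq> 0"
    then have pos: "0 < prob N" using measure_nonneg[of M N] by linarith
    obtain i where "R / prob N < real i" using reals_Archimedean2 by blast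
    then have "R < real i * prob N" using pos by (simp add: divide_less_eq)
    also have "\<dots> \<le> real (Suc i) * prob N" using pos by simp
    finally show False using bd[of i] by simp
  qed
  then have "N \<in> null_sets M" using NM by (simp add: null_sets_def emeasure_eq_measure)
  then show ?thesis
  proof (rule AE_I')
    show "{\<omega> \<in> space M. \<not> (\<forall>t\<in>{0..T}. 0 < X t \<omega>)} \<subseteq> N"
    proof (rule subsetI)
      fix \<omega> assume "\<omega> \<in> {\<omega> \<in> space M. \<not> (\<forall>t\<in>{0..T}. 0 < X t \<omega>)}"
      then obtain t where w: "\<omega> \<in> space M" and t: "t \<in> {0..T}" and neg: "\<not> 0 < X t \<omega>" by blast
      show "\<omega> \<in> N"
        unfolding N_def U_def
      proof (rule INT_I)
        fix i
        have "X t \<omega> < e i" using neg e(1)[of i] by simp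
        then have "\<forall>\<^sub>F n in sequentially. X (real (floor_idx n t) * mesh n) \<omega> < e i"
          by (rule order_tendstoD(2)[OF X_floor_tendsto[OF t w]])
        then obtain n where "X (real (floor_idx n t) * mesh n) \<omega> < e i"
          by (auto simp: eventually_sequentially)
        then have "\<omega> \<notin> stays_above (e i) n (2 ^ n)"
          using floor_idx(1)[OF t, of n] by (auto simp: stays_above_def not_le)
        then show "\<omega> \<in> (\<Union>m. space M - stays_above (e i) m (2 ^ m))" using w by blast
      qed
    qed
  qed
qed

end

section \<open>Both boundaries: application to \<open>X\<close> and \<open>1 - X\<close>\<close>

theorem mainTheorem2:
  fixes M :: "'a measure" and F :: "real \<Rightarrow> 'a measure"
    and W X :: "real \<Rightarrow> 'a \<Rightarrow> real"
    and T \<alpha> \<theta>0 x0 :: real and \<theta> p p' :: "real \<Rightarrow> real"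
  assumes T_pos: "T > 0" and alpha_pos: "\<alpha> > 0" and theta0_pos: "\<theta>0 > 0"
    and theta_meas: "\<theta> \<in> borel_measurable borel"
    and theta_pos: "\<forall>t\<in>{0..T}. \<theta> t > 0"
    and theta_bdd: "\<exists>B. \<forall>t\<in>{0..T}. \<bar>\<theta> t\<bar> \<le> B"
    and p_deriv: "\<forall>t\<in>{0..T}. (p has_real_derivative p' t) (at t within {0..T})"
    and p'_cont: "continuous_on {0..T} p'"
    and p_bdd: "\<exists>B. \<forall>t\<in>{0..T}. \<bar>p t\<bar> + \<bar>p' t\<bar> \<le> B"
    and p_range: "\<forall>t\<in>{0..T}. 0 < p t \<and> p t < 1"
    and condA: "\<forall>t\<in>{0..T}. 0 \<le> p' t + \<theta> t * p t \<and> p' t + \<theta> t * p t \<le> \<theta> t"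
    and x0_range: "0 < x0" "x0 < 1"
    and BM: "brownian_motion M F T W"
    and sol: "strong_solution M F T W
                (\<lambda>t x. p' t - \<theta> t * (x - p t))
                (\<lambda>x. sqrt (2 * \<alpha> * \<theta>0 * x * (1 - x))) x0 X"
    and condB: "\<forall>t\<in>{0..T}. \<theta> t \<ge> max ((\<alpha> * \<theta>0 + p' t) / (1 - p t)) ((\<alpha> * \<theta>0 - p' t) / p t)"
  shows "AE \<omega> in M. \<forall>t\<in>{0..T}. 0 < X t \<omega> \<and> X t \<omega> < 1"
proof -
  interpret prob_space M using BM by (simp add: brownian_motion_def)
  define a where "a = \<alpha> * \<theta>0"
  define \<beta> where "\<beta> t = p' t + \<theta> t * p t" for t
  define \<sigma> where "\<sigma> x = sqrt (2 * \<alpha> * \<theta>0 * x * (1 - x))" for x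
  obtain K where K: "\<bar>\<theta> t\<bar> \<le> K" if "t \<in> {0..T}" for t using theta_bdd by blast
  have a: "0 < a" using alpha_pos theta0_pos by (simp add: a_def)
  have \<theta>: "0 \<le> \<theta> t" "\<theta> t \<le> K" if "t \<in> {0..T}" for t
    using theta_pos K[OF that] that by (auto simp: less_imp_le)
  \<comment> \<open>The two halves of condition (B) with denominators cleared: the one over p bounds
    the inward drift at 0, the one over 1 - p the inward drift at 1.\<close>
  have \<beta>: "a \<le> \<beta> t" "\<beta> t \<le> \<theta> t - a" if "t \<in> {0..T}" for t
  proof -
    have "(\<alpha> * \<theta>0 - p' t) / p t \<le> \<theta> t" "(\<alpha> * \<theta>0 + p' t) / (1 - p t) \<le> \<theta> t" "0 < p t" "0 < 1 - p t"
      using condB p_range that by auto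
    then show "a \<le> \<beta> t" "\<beta> t \<le> \<theta> t - a"
      by (auto simp: a_def \<beta>_def divide_le_eq right_diff_distrib)
  qed
  have \<theta>m: "(\<lambda>t. indicator {0..T} t * \<theta> t) \<in> borel_measurable borel"
    using theta_meas by measurable
  have pc: "continuous_on {0..T} p"
    using p_deriv by (auto simp: continuous_on_eq_continuous_within intro: DERIV_continuous)
  have \<beta>m: "(\<lambda>t. indicator {0..T} t * \<beta> t) \<in> borel_measurable borel"
  proof -
    have [measurable]: "(\<lambda>t. indicator {0..T} t * p t) \<in> borel_measurable borel"
      "(\<lambda>t. indicator {0..T} t * p' t) \<in> borel_measurable borel"
      using borel_measurable_continuous_on_indicator[OF _ pc] borel_measurable_continuous_on_indicator[OF _ p'_cont] by auto
    have "(\<lambda>t. indicator {0..T} t * p' t + (indicator {0..T} t * \<theta> t) * (indicator {0..T} t * p t)) \<in> borel_measurable borel"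
      using \<theta>m by measurable
    also have "(\<lambda>t. indicator {0..T} t * p' t + (indicator {0..T} t * \<theta> t) * (indicator {0..T} t * p t)) = (\<lambda>t. indicator {0..T} t * \<beta> t)"
      by (auto simp: fun_eq_iff \<beta>_def indicator_def)
    finally show ?thesis .
  qed
  have \<beta>'m: "(\<lambda>t. indicator {0..T} t * (\<theta> t - \<beta> t)) \<in> borel_measurable borel"
    using borel_measurable_diff[OF \<theta>m \<beta>m] by (simp add: right_diff_distrib)
  \<comment> \<open>\<open>sqrt\<close> is total and odd, so it is continuous for negative arguments
    too.\<close>
  have \<sigma>c: "continuous_on S \<sigma>" for S unfolding \<sigma>_def by (intro continuous_intros)
  have \<sigma>2: "(\<sigma> x)\<^sup>2 = 2 * a * (x * (1 - x))" if "x \<in> {0..1}" for x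
  proof -
    have "0 \<le> 2 * \<alpha> * \<theta>0 * x * (1 - x)" using that alpha_pos theta0_pos by auto
    then show ?thesis by (simp add: \<sigma>_def a_def mult.assoc)
  qed
  have solX: "strong_solution M F T W (\<lambda>t x. \<beta> t - \<theta> t * x) \<sigma> x0 X"
    using sol unfolding \<beta>_def \<sigma>_def by (simp add: algebra_simps)
  \<comment> \<open>Reflection with the same Brownian motion: the minus sign in the volatility
    negates every Ito sum, and the drift integral changes its sign as well, so the approximation
    errors have the same absolute values.\<close>
  have solY: "strong_solution M F T W (\<lambda>t y. (\<theta> t - \<beta> t) - \<theta> t * y) (\<lambda>y. - \<sigma> (1 - y)) (1 - x0) (\<lambda>t \<omega>. 1 - X t \<omega>)"
    unfolding strong_solution_def
  proof (intro conjI ballI)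
    show "adapted_on T F (\<lambda>t \<omega>. 1 - X t \<omega>)"
      using solX unfolding strong_solution_def adapted_on_def by auto
  next
    fix t assume t: "t \<in> {0..T}"
    have ito: "ito_sum W (\<lambda>s \<omega>. - \<sigma> (1 - (1 - X s \<omega>))) t n \<omega> = - ito_sum W (\<lambda>s \<omega>. \<sigma> (X s \<omega>)) t n \<omega>" for n \<omega>
      unfolding ito_sum_def by (simp add: sum_negf)
    have "integral {0..t} (\<lambda>s. \<theta> s - \<beta> s - \<theta> s * (1 - X s \<omega>)) = - integral {0..t} (\<lambda>s. \<beta> s - \<theta> s * X s \<omega>)" for \<omega>
      by (subst integral_neg[symmetric]) (simp add: algebra_simps)
    then have "\<bar>- ito_sum W (\<lambda>s \<omega>. \<sigma> (X s \<omega>)) t n \<omega> - (1 - X t \<omega> - (1 - x0) - integral {0..t} (\<lambda>s. \<theta> s - \<beta> s - \<theta> s * (1 - X s \<omega>)))\<bar>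
      = \<bar>ito_sum W (\<lambda>s \<omega>. \<sigma> (X s \<omega>)) t n \<omega> - (X t \<omega> - x0 - integral {0..t} (\<lambda>s. \<beta> s - \<theta> s * X s \<omega>))\<bar>" for n \<omega>
      by simp
    then show "is_ito_integral M W (\<lambda>s \<omega>. - \<sigma> (1 - (1 - X s \<omega>))) t
        (\<lambda>\<omega>. 1 - X t \<omega> - (1 - x0) - integral {0..t} (\<lambda>s. \<theta> s - \<beta> s - \<theta> s * (1 - X s \<omega>)))"
      using solX t unfolding strong_solution_def is_ito_integral_def ito by simp
  qed (use solX in \<open>auto simp: strong_solution_def intro!: continuous_intros\<close>)
  interpret SX: affine_drift_sde M F T W \<beta> \<theta> \<sigma> x0 a K X
  proof unfold_locales
    show "(\<sigma> x)\<^sup>2 \<le> 2 * a * x" if "x \<in> {0..1}" for x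
    proof -
      have "x * (1 - x) \<le> x * 1" using that by (intro mult_left_mono) auto
      then show ?thesis using that a by (simp add: \<sigma>2)
    qed
    show "\<beta> t \<le> K" if "t \<in> {0..T}" for t using \<beta>[OF that] \<theta>[OF that] a by linarith
  qed (use T_pos a \<beta> \<beta>m \<theta> \<theta>m \<sigma>c x0_range BM solX in auto)
  interpret SY: affine_drift_sde M F T W "\<lambda>t. \<theta> t - \<beta> t" \<theta> "\<lambda>y. - \<sigma> (1 - y)" "1 - x0" a K "\<lambda>t \<omega>. 1 - X t \<omega>"
  proof unfold_locales
    show "(- \<sigma> (1 - y))\<^sup>2 \<le> 2 * a * y" if "y \<in> {0..1}" for y
    proof -
      have "(1 - y) * (1 - (1 - y)) \<le> 1 * y" using that by (intro mult_mono) auto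
      then show ?thesis using that a \<sigma>2[of "1 - y"] by simp
    qed
    show "continuous_on {0..1} (\<lambda>y. - \<sigma> (1 - y))"
      by (intro continuous_on_minus continuous_on_compose2[OF \<sigma>c[of UNIV]] continuous_intros) auto
    show "\<theta> t - \<beta> t \<le> K" "a \<le> \<theta> t - \<beta> t" if "t \<in> {0..T}" for t using \<beta>[OF that] \<theta>[OF that] a by linarith+
  qed (use T_pos a \<beta>'m \<theta> \<theta>m x0_range BM solY in auto)
  show ?thesis
    using SX.AE_solution_pos SY.AE_solution_pos by eventually_elim auto
qed

end
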